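(* The Minimum-Power Edge-Multi-Cover problem (MPEMC) admits a polynomial-time $(k+1/2)$-approximation algorithm, where $k=\max_{v\in V} r(v)$ is the maximum degree bound of the instance.
   Context: All graphs are undirected and simple. For a graph $(V,J)$ with edge costs $c$, and $v\in V$, let $\delta_J(v)$ be the set of edges of $J$ incident to $v$ and $d_J(v)=|\delta_J(v)|$. The power of $v$ w.r.t. $J$ is $p_J(v)=\max_{e\in\delta_J(v)}c(e)$ if $\delta_J(v)\neq\emptyset$ and $p_J(v)=0$ otherwise; for $V'\subseteq V$, $p_J(V')=\sum_{v\in V'}p_J(v)$, and the power of $J$ is $p_J(V)$. Given degree bounds $r=\{r(v):v\in V\}$ (nonnegative integers), an edge set $J$ on $V$ is an $r$-edge cover if $d_J(v)\ge r(v)$ for every $v\in V$. MPEMC: given a graph $G=(V,E)$ with edge costs $\{c(e):e\in E\}$ and degree bounds $r$, find an $r$-edge cover $J\subseteq E$ of minimum power $p_J(V)$. A $\rho$-approximation algorithm is a polynomial-time algorithm returning a feasible solution whose power is at most $\rho$ times the optimum. *)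

theory Defs
  imports Complex_Main "HOL-Library.Log_Nat" "HOL-Computational_Algebra.Polynomial"
begin

section \<open>Power of edge sets and edge-multi-covers\<close>

text \<open>An undirected edge is a two-element set of vertices.\<close>

record 'v mpemc =
  verts :: "'v set"
  edges :: "'v set set"
  cost  :: "'v set \<Rightarrow> rat"
  bound :: "'v \<Rightarrow> nat"

definition mpemc_instance :: "'v mpemc \<Rightarrow> bool" where
  "mpemc_instance G \<longleftrightarrow>
     finite (verts G) \<and>
     (\<forall>e\<in>edges G. e \<subseteq> verts G \<and> card e = 2) \<and>
     (\<forall>e\<in>edges G. 0 \<le> cost G e)"

definition incident :: "'v set set \<Rightarrow> 'v \<Rightarrow> 'v set set" where
  "incident J v = {e \<in> J. v \<in> e}"

definition degree_in :: "'v set set \<Rightarrow> 'v \<Rightarrow> nat" where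
  "degree_in J v = card (incident J v)"

definition node_power :: "('v set \<Rightarrow> rat) \<Rightarrow> 'v set set \<Rightarrow> 'v \<Rightarrow> rat" where
  "node_power c J v = (if incident J v = {} then 0 else Max (c ` incident J v))"

definition power_on :: "('v set \<Rightarrow> rat) \<Rightarrow> 'v set set \<Rightarrow> 'v set \<Rightarrow> rat" where
  "power_on c J U = (\<Sum>v\<in>U. node_power c J v)"

definition edge_cover :: "'v set \<Rightarrow> ('v \<Rightarrow> nat) \<Rightarrow> 'v set set \<Rightarrow> bool" where
  "edge_cover V r J \<longleftrightarrow> (\<forall>v\<in>V. r v \<le> degree_in J v)"

definition solutions :: "'v mpemc \<Rightarrow> 'v set set set" where
  "solutions G = {J. J \<subseteq> edges G \<and> edge_cover (verts G) (bound G) J}"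

definition power_of :: "'v mpemc \<Rightarrow> 'v set set \<Rightarrow> rat" where
  "power_of G J = power_on (cost G) J (verts G)"

text \<open>Only meaningful if \<^term>\<open>solutions G \<noteq> {}\<close>.\<close>

definition opt_power :: "'v mpemc \<Rightarrow> rat" where
  "opt_power G = Min (power_of G ` solutions G)"

text \<open>For an empty vertex set this is unspecified, but then every power is 0.\<close>

definition max_bound :: "'v mpemc \<Rightarrow> nat" where
  "max_bound G = Max (bound G ` verts G)"


section \<open>Machine model\<close>

text \<open>
  A structured random access machine on natural numbers. The memory consists of arrays that
  are selected by name and indexed by computed addresses; a program mentions only finitely
  many names, so this is ordinary indirect addressing into finitely many interleaved
  memories. \<open>Sub\<close> is truncated subtraction and \<open>Half\<close> rounds down; conditionals and loops
  test for being nonzero.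

  Every elementary operation costs one unit. There is deliberately no multiplication: a unit
  of time can at most double the largest number present, so numbers occurring within time
  \<open>t\<close> have \<open>O(t)\<close> bits more than the input. Hence, as for the usual random access machine with
  addition, subtraction and halving, polynomial time in this model (measured in the binary
  length of the input) coincides with polynomial time on Turing machines.
\<close>

datatype expr =
    Num nat
  | Cell string expr
  | Add expr expr
  | Sub expr expr
  | Half expr

datatype prog =
    Skip
  | Store string expr expr
  | Seq prog prog
  | Cond expr prog prog
  | While expr prog

type_synonym memory = "string \<Rightarrow> nat \<Rightarrow> nat"

primrec expr_val :: "expr \<Rightarrow> memory \<Rightarrow> nat" where
  "expr_val (Num n) s = n"
| "expr_val (Cell a e) s = s a (expr_val e s)"
| "expr_val (Add e f) s = expr_val e s + expr_val f s"
| "expr_val (Sub e f) s = expr_val e s - expr_val f s"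
| "expr_val (Half e) s = expr_val e s div 2"

primrec expr_time :: "expr \<Rightarrow> nat" where
  "expr_time (Num n) = 1"
| "expr_time (Cell a e) = 1 + expr_time e"
| "expr_time (Add e f) = 1 + expr_time e + expr_time f"
| "expr_time (Sub e f) = 1 + expr_time e + expr_time f"
| "expr_time (Half e) = 1 + expr_time e"

text \<open>\<open>exec p s t s'\<close>: started in memory \<open>s\<close>, program \<open>p\<close> halts after \<open>t\<close> units of time in
  memory \<open>s'\<close>. In \<open>Store a e f\<close>, \<open>e\<close> is the address and \<open>f\<close> the value.\<close>

inductive exec :: "prog \<Rightarrow> memory \<Rightarrow> nat \<Rightarrow> memory \<Rightarrow> bool" where
  exec_Skip:
    "exec Skip s 1 s"
| exec_Store:
    "exec (Store a e f) s (1 + expr_time e + expr_time f)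
       (s(a := (s a)(expr_val e s := expr_val f s)))"
| exec_Seq:
    "exec p s t s' \<Longrightarrow> exec q s' u s'' \<Longrightarrow> exec (Seq p q) s (t + u) s''"
| exec_Cond_true:
    "expr_val e s \<noteq> 0 \<Longrightarrow> exec p s t s' \<Longrightarrow> exec (Cond e p q) s (1 + expr_time e + t) s'"
| exec_Cond_false:
    "expr_val e s = 0 \<Longrightarrow> exec q s t s' \<Longrightarrow> exec (Cond e p q) s (1 + expr_time e + t) s'"
| exec_While_true:
    "expr_val e s \<noteq> 0 \<Longrightarrow> exec p s t s' \<Longrightarrow> exec (While e p) s' u s'' \<Longrightarrow>
     exec (While e p) s (1 + expr_time e + t + u) s''"
| exec_While_false:
    "expr_val e s = 0 \<Longrightarrow> exec (While e p) s (1 + expr_time e) s"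

inductive_cases exec_SkipE: "exec Skip s t s'"
inductive_cases exec_StoreE: "exec (Store a e f) s t s'"
inductive_cases exec_SeqE: "exec (Seq p q) s t s'"
inductive_cases exec_CondE: "exec (Cond e p q) s t s'"
inductive_cases exec_WhileE: "exec (While e p) s t s'"

lemma exec_deterministic:
  "exec p s t s' \<Longrightarrow> exec p s u s'' \<Longrightarrow> u = t \<and> s'' = s'"
proof (induction arbitrary: u s'' rule: exec.induct)
  case (exec_Skip s)
  then show ?case by (auto elim: exec_SkipE)
next
  case (exec_Store a e f s)
  then show ?case by (auto elim: exec_StoreE)
next
  case (exec_Seq p s t s' q v r)
  from exec_Seq.prems show ?case
    by (rule exec_SeqE) (auto dest: exec_Seq.IH)
next
  case (exec_Cond_true e s p t s' q)
  from exec_Cond_true.prems show ?case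
    by (rule exec_CondE) (auto simp: exec_Cond_true.hyps dest: exec_Cond_true.IH)
next
  case (exec_Cond_false e s q t s' p)
  from exec_Cond_false.prems show ?case
    by (rule exec_CondE) (auto simp: exec_Cond_false.hyps dest: exec_Cond_false.IH)
next
  case (exec_While_true e s p t s' v r)
  from exec_While_true.prems show ?case
    by (rule exec_WhileE) (auto simp: exec_While_true.hyps dest: exec_While_true.IH)
next
  case (exec_While_false e s p)
  from exec_While_false.prems show ?case
    by (rule exec_WhileE) (auto simp: exec_While_false.hyps)
qed

definition input_memory :: "nat list \<Rightarrow> memory" where
  "input_memory xs = (\<lambda>a i. if a = ''input'' \<and> i < length xs then xs ! i else 0)"

text \<open>Binary lengths, with one extra bit per number (so that zero also counts).\<close>

definition input_size :: "nat list \<Rightarrow> nat" where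
  "input_size xs = (\<Sum>x\<leftarrow>xs. Suc (floorlog 2 x))"


section \<open>Approximation algorithms for edge-multi-covers\<close>

text \<open>
  The vertices of an encoded instance are numbered \<open>0, ..., n - 1\<close>. Its edges are listed
  without repetition, in any order and with either order of the end points, as \<open>(u, v, a, b)\<close>
  where \<open>a / b\<close> is the cost of \<open>{u, v}\<close>, not necessarily in lowest terms.
\<close>

definition edge_of :: "nat \<times> nat \<times> nat \<times> nat \<Rightarrow> nat set" where
  "edge_of = (\<lambda>(u, v, a, b). {u, v})"

definition edge_listing :: "nat mpemc \<Rightarrow> (nat \<times> nat \<times> nat \<times> nat) list \<Rightarrow> bool" where
  "edge_listing G es \<longleftrightarrow>
     distinct (map edge_of es) \<and> edge_of ` set es = edges G \<and>
     (\<forall>(u, v, a, b)\<in>set es. b > 0 \<and> cost G {u, v} = of_nat a / of_nat b)"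

definition encode :: "nat mpemc \<Rightarrow> (nat \<times> nat \<times> nat \<times> nat) list \<Rightarrow> nat list" where
  "encode G es =
     card (verts G) # length es # map (bound G) [0..<card (verts G)] @
     concat (map (\<lambda>(u, v, a, b). [u, v, a, b]) es)"

text \<open>The output is a characteristic vector: its nonzero entries mark the selected edges.\<close>

definition output_edges :: "(nat \<times> nat \<times> nat \<times> nat) list \<Rightarrow> memory \<Rightarrow> nat set set" where
  "output_edges es s = {edge_of (es ! i) | i. i < length es \<and> s ''output'' i \<noteq> 0}"

text \<open>
  The running time is bounded on all instances; the quality of the output matters only for
  instances that have a solution at all. The ratio may depend on the instance.
\<close>

definition mpemc_approximation :: "prog \<Rightarrow> (nat mpemc \<Rightarrow> rat) \<Rightarrow> bool" where
  "mpemc_approximation P \<rho> \<longleftrightarrow>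
     (\<exists>T :: nat poly. \<forall>G es.
        mpemc_instance G \<and> verts G = {..<card (verts G)} \<and> edge_listing G es \<longrightarrow>
        (\<exists>t s. exec P (input_memory (encode G es)) t s \<and>
           t \<le> poly T (input_size (encode G es)) \<and>
           (solutions G \<noteq> {} \<longrightarrow>
              output_edges es s \<in> solutions G \<and>
              power_of G (output_edges es s) \<le> \<rho> G * opt_power G)))"

end

theory Submission
  imports Defs
begin

text \<open>
  Let \<open>base v\<close> be the cost of the \<open>r v\<close>-th cheapest edge at \<open>v\<close>; every solution has power at least
  \<open>base v\<close> at \<open>v\<close>. The \<open>r v - 1\<close> cheapest edges at all vertices \<open>v\<close> cost at most
  \<open>(k - 1) * sum base V\<close> at their other ends, and then each vertex lacks one edge. Buying this edge
  for every vertex costs another \<open>sum base V\<close>. To save half of it, stars are bought first, whenever the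
  values \<open>base v\<close> of the vertices newly covered by a star exceed twice its cost (the excess of its
  edges over \<open>base\<close>). Covering more vertices only makes a star less attractive, so one pass over all
  stars suffices, and after it an optimal solution, split into stars, shows that the uncovered
  vertices have total \<open>base\<close> value at most twice the excess of the optimum. With \<open>x\<close> the value of the
  covered and \<open>y\<close> that of the uncovered vertices, \<open>b = x + y\<close>, the total is at most
  \<open>b + x / 2 + y + (k - 1) * b = (k + 1 / 2) * b + y / 2\<close> and \<open>y / 2 \<le> opt - b\<close>.
\<close>

section \<open>Stars and coverage in graphs given by darts\<close>

text \<open>The power of a vertex is a maximum, so it is not additive in the edges. The proof works
  instead with level functions \<open>L\<close> satisfying \<open>c d \<le> L (src d)\<close> for
  all darts of the bought edges: successive purchases just add increments to a level, and the least
  level of a solution is its power. A star is a bargain because its centre pays only for its dearest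
  dart. Once that dart is fixed, the leaves no longer interact, so one candidate star per dart is
  enough. Edges are split into two darts because the same edge can be early at one end and late at
  the other, and can be bought by either end. With threshold 2 the estimates add up to
  \<open>(k - 1/2) * b + opt\<close>, so the factor \<open>k + 1/2\<close> only needs
  \<open>b \<le> opt\<close> and a nonnegative coefficient, that is \<open>k \<ge> 1\<close>; the
  case \<open>k = 0\<close> is treated separately.\<close>

locale dart_graph =
  fixes V :: "'v set" and D :: "'d set"
    and src dst :: "'d \<Rightarrow> 'v" and mate :: "'d \<Rightarrow> 'd" and ed :: "'d \<Rightarrow> nat"
    and c :: "'d \<Rightarrow> nat" and r :: "'v \<Rightarrow> nat"
  assumes finite_V [simp]: "finite V" and finite_D [simp]: "finite D"
    and src_V [simp]: "d \<in> D \<Longrightarrow> src d \<in> V"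
    and mate_D [simp]: "d \<in> D \<Longrightarrow> mate d \<in> D"
    and src_mate [simp]: "d \<in> D \<Longrightarrow> src (mate d) = dst d"
    and dst_mate [simp]: "d \<in> D \<Longrightarrow> dst (mate d) = src d"
    and c_mate [simp]: "d \<in> D \<Longrightarrow> c (mate d) = c d"
    and ed_mate [simp]: "d \<in> D \<Longrightarrow> ed (mate d) = ed d"
    and ed_eq: "d \<in> D \<Longrightarrow> d' \<in> D \<Longrightarrow> ed d = ed d' \<Longrightarrow> d' = d \<or> d' = mate d"
    and no_loop: "d \<in> D \<Longrightarrow> src d \<noteq> dst d"
    and simple: "d \<in> D \<Longrightarrow> d' \<in> D \<Longrightarrow> src d = src d' \<Longrightarrow> dst d = dst d' \<Longrightarrow> d = d'"
begin

text \<open>Ties are broken by the edge number and not by the dart, so that both orientations of an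
  edge compare alike; ranks thereby become invariant under \<open>mate\<close>.\<close>

definition cheaper :: "'d \<Rightarrow> 'd \<Rightarrow> bool" where
  "cheaper d' d \<longleftrightarrow> c d' < c d \<or> (c d' = c d \<and> ed d' < ed d)"

text \<open>The vertex is a separate argument because a dart is also ranked at its target, where it
  stands for its mate. Ranks start at 0.\<close>

definition rk :: "'v \<Rightarrow> 'd \<Rightarrow> nat" where
  "rk v d = card {d' \<in> D. src d' = v \<and> cheaper d' d}"

text \<open>The edge is not among the \<open>r v - 1\<close> cheapest at \<open>v\<close>. Avoiding
  the subtraction makes every edge late where \<open>r v = 0\<close>.\<close>

definition late :: "'v \<Rightarrow> 'd \<Rightarrow> bool" where
  "late v d \<longleftrightarrow> r v \<le> rk v d + 1"

text \<open>The cost of the \<open>r v\<close>-th cheapest edge at \<open>v\<close>, if it exists; the sum has at most one term.\<close>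

definition base :: "'v \<Rightarrow> nat" where
  "base v = (\<Sum>d | d \<in> D \<and> src d = v \<and> rk v d + 1 = r v. c d)"

text \<open>Truncated subtraction: an edge no dearer than \<open>base v\<close> does not raise the
  level at \<open>v\<close>.\<close>

definition excess :: "'v \<Rightarrow> 'd \<Rightarrow> nat" where
  "excess v d = c d - base v"

text \<open>Only a late edge can cover a vertex, because the early edges are bought in any
  case.\<close>

definition leaf_gain :: "'v set \<Rightarrow> 'd \<Rightarrow> nat" where
  "leaf_gain K d = (if dst d \<notin> K \<and> late (dst d) d then base (dst d) else 0)"

definition centre_gain :: "'v set \<Rightarrow> 'd \<Rightarrow> nat" where
  "centre_gain K d = (if src d \<notin> K \<and> late (src d) d then base (src d) else 0)"

text \<open>\<open>d0\<close> fixes the level of the centre, so it belongs to the star even if its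
  own leaf brings no profit. Every other leaf is then decided on its own.\<close>

definition star :: "'v set \<Rightarrow> 'd \<Rightarrow> 'd set" where
  "star K d0 = {d \<in> D. d = d0 \<or>
     (src d = src d0 \<and> c d \<le> c d0 \<and> leaf_gain K d > 2 * excess (dst d) d)}"

definition gain :: "'v set \<Rightarrow> 'd \<Rightarrow> nat" where
  "gain K d0 = centre_gain K d0 + (\<Sum>d\<in>star K d0. leaf_gain K d)"

text \<open>Twice the rise of the level, which is the threshold for buying; the centre pays once,
  for its dearest dart \<open>d0\<close>.\<close>

definition loss :: "'v set \<Rightarrow> 'd \<Rightarrow> nat" where
  "loss K d0 = 2 * excess (src d0) d0 + (\<Sum>d\<in>star K d0. 2 * excess (dst d) d)"

definition step :: "'d \<Rightarrow> 'v set \<times> nat set \<Rightarrow> 'v set \<times> nat set" where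
  "step d0 = (\<lambda>(K, S). if loss K d0 < gain K d0
     then (K \<union> dst ` {d \<in> star K d0. late (dst d) d} \<union> (if late (src d0) d0 then {src d0} else {}),
           S \<union> ed ` star K d0)
     else (K, S))"

definition early_edges :: "nat set" where
  "early_edges = {ed d | d. d \<in> D \<and> rk (src d) d + 1 < r (src d)}"

definition fallback :: "'v set \<Rightarrow> nat set" where
  "fallback K = {ed d | d. d \<in> D \<and> rk (src d) d + 1 = r (src d) \<and> src d \<notin> K}"

definition greedy :: "'d list \<Rightarrow> 'v set \<times> nat set" where
  "greedy ds = fold step ds ({}, early_edges)"

definition chosen :: "'d list \<Rightarrow> nat set" where
  "chosen ds = (case greedy ds of (K, S) \<Rightarrow> S \<union> fallback K)"

definition darts_at :: "'v \<Rightarrow> 'd set" where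
  "darts_at v = {d \<in> D. src d = v}"

definition feasible :: "nat set \<Rightarrow> bool" where
  "feasible S \<longleftrightarrow> (\<forall>v\<in>V. r v \<le> card {d \<in> darts_at v. ed d \<in> S})"

section \<open>Ranking of the darts at a vertex\<close>

lemma finite_darts_at [simp]: "finite (darts_at v)"
  by (simp add: darts_at_def)

lemma dst_V [simp]: "d \<in> D \<Longrightarrow> dst d \<in> V"
  using src_V[OF mate_D] by simp

lemma rk_mate [simp]: "d \<in> D \<Longrightarrow> rk v (mate d) = rk v d"
  by (simp add: rk_def cheaper_def)

lemma late_mate [simp]: "d \<in> D \<Longrightarrow> late v (mate d) = late v d"
  by (simp add: late_def)

lemma inj_on_ed_darts_at: "inj_on ed (darts_at v)"
proof (rule inj_onI)
  fix d d' assume "d \<in> darts_at v" "d' \<in> darts_at v" "ed d = ed d'"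
  then show "d = d'"
    using ed_eq[of d d'] no_loop[of d] src_mate[of d] by (auto simp: darts_at_def)
qed

lemma inj_on_dst_darts_at: "inj_on dst (darts_at v)"
  by (rule inj_onI) (auto simp: darts_at_def intro: simple)

lemma cheaper_linear:
  "d \<in> darts_at v \<Longrightarrow> d' \<in> darts_at v \<Longrightarrow> d \<noteq> d' \<Longrightarrow> cheaper d d' \<or> cheaper d' d"
  using inj_on_ed_darts_at[of v] unfolding cheaper_def inj_on_def by (metis linorder_neqE_nat)

lemma cheaper_trans: "cheaper a b \<Longrightarrow> cheaper b d \<Longrightarrow> cheaper a d"
  by (auto simp: cheaper_def)

lemma rk_eq: "rk v d = card {d' \<in> darts_at v. cheaper d' d}"
  by (simp add: rk_def darts_at_def conj_assoc)

lemma rk_less: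
  assumes "d \<in> darts_at v" "cheaper d d'"
  shows "rk v d < rk v d'"
  unfolding rk_eq
proof (rule psubset_card_mono)
  have "\<not> cheaper d d" by (simp add: cheaper_def)
  then show "{x \<in> darts_at v. cheaper x d} \<subset> {x \<in> darts_at v. cheaper x d'}"
    using assms cheaper_trans by blast
qed simp

lemma inj_on_rk: "inj_on (rk v) (darts_at v)"
  by (rule inj_onI) (metis cheaper_linear rk_less less_irrefl)

lemma rk_less_card: "d \<in> darts_at v \<Longrightarrow> rk v d < card (darts_at v)"
  unfolding rk_eq
  by (rule psubset_card_mono) (auto simp: cheaper_def)

text \<open>An injective map into an initial segment of the same size is onto. So every rank below
  the degree occurs, which later supplies the dart behind \<open>base v\<close>.\<close>

lemma bij_betw_rk: "bij_betw (rk v) (darts_at v) {..<card (darts_at v)}"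
proof -
  have "rk v ` darts_at v = {..<card (darts_at v)}"
    by (rule card_subset_eq) (auto simp: rk_less_card card_image[OF inj_on_rk])
  then show ?thesis using inj_on_rk by (simp add: bij_betw_def)
qed

lemma cost_mono_rk: "d \<in> darts_at v \<Longrightarrow> d' \<in> darts_at v \<Longrightarrow> rk v d \<le> rk v d' \<Longrightarrow> c d \<le> c d'"
  by (metis cheaper_def cheaper_linear leD le_less_linear nat_less_le order_refl rk_less)

lemma base_0: "r v = 0 \<Longrightarrow> base v = 0"
  by (simp add: base_def)

lemma base_eq:
  assumes "d \<in> darts_at v" "rk v d + 1 = r v"
  shows "base v = c d"
proof -
  have "{d \<in> D. src d = v \<and> rk v d + 1 = r v} = {d}"
    using assms inj_onD[OF inj_on_rk, of v _ d] by (auto simp: darts_at_def)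
  then show ?thesis unfolding base_def by simp
qed

lemma card_early:
  assumes "r v \<le> card (darts_at v)"
  shows "card {d \<in> darts_at v. rk v d + 1 < r v} = r v - 1"
proof -
  have "bij_betw (rk v) {d \<in> darts_at v. rk v d + 1 < r v} {..<r v - 1}"
    unfolding bij_betw_def
  proof
    show "inj_on (rk v) {d \<in> darts_at v. rk v d + 1 < r v}"
      using inj_on_rk by (rule inj_on_subset) auto
    have "i \<in> rk v ` {d \<in> darts_at v. rk v d + 1 < r v}" if "i < r v - 1" for i
    proof -
      have "i \<in> rk v ` darts_at v" using that assms bij_betw_rk[of v] by (auto simp: bij_betw_def)
      then show ?thesis using that by auto
    qed
    then show "rk v ` {d \<in> darts_at v. rk v d + 1 < r v} = {..<r v - 1}" by auto
  qed
  then show ?thesis by (simp add: bij_betw_same_card)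
qed

section \<open>Profit of stars and its monotonicity\<close>

definition stable :: "'v set \<Rightarrow> 'd \<Rightarrow> bool" where
  "stable K d0 \<longleftrightarrow> gain K d0 \<le> loss K d0"

lemma star_subset: "d0 \<in> D \<Longrightarrow> star K d0 \<subseteq> darts_at (src d0)"
  by (auto simp: star_def darts_at_def)

lemma finite_star [simp]: "finite (star K d0)"
  by (simp add: star_def)

text \<open>The star taken by the algorithm is the best one with the prescribed most expensive dart.\<close>

lemma stable_iff:
  assumes "d0 \<in> D"
  shows "stable K d0 \<longleftrightarrow>
    (\<forall>I. d0 \<in> I \<longrightarrow> I \<subseteq> darts_at (src d0) \<longrightarrow> (\<forall>d\<in>I. c d \<le> c d0) \<longrightarrow>
      centre_gain K d0 + (\<Sum>d\<in>I. leaf_gain K d)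
        \<le> 2 * excess (src d0) d0 + (\<Sum>d\<in>I. 2 * excess (dst d) d))"
    (is "_ \<longleftrightarrow> ?R")
proof
  assume ?R
  then show "stable K d0"
    unfolding stable_def gain_def loss_def
    by (elim allE[of _ "star K d0"]) (use assms in \<open>auto simp: star_def darts_at_def\<close>)
next
  assume st: "stable K d0"
  show ?R
  proof (intro allI impI)
    fix I assume I: "d0 \<in> I" "I \<subseteq> darts_at (src d0)" "\<forall>d\<in>I. c d \<le> c d0"
    \<comment> \<open>The signed profit of a leaf. Admissible darts outside the star have profit at
      most 0, and star darts other than \<open>d0\<close> have positive profit; \<open>d0\<close>
      itself lies in both sets.\<close>
    let ?f = "\<lambda>d. int (leaf_gain K d) - int (2 * excess (dst d) d)"
    have fin: "finite I" using I(2) finite_darts_at by (rule finite_subset)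
    have "sum ?f I = sum ?f (I \<inter> star K d0) + sum ?f (I - star K d0)"
      using fin by (rule sum.Int_Diff)
    moreover have "sum ?f (I - star K d0) \<le> 0"
      by (rule sum_nonpos) (use I in \<open>force simp: star_def darts_at_def\<close>)
    moreover have "sum ?f (I \<inter> star K d0) \<le> sum ?f (star K d0)"
      by (rule sum_mono2) (use I(1) in \<open>auto simp: star_def\<close>)
    ultimately have "sum ?f I \<le> sum ?f (star K d0)" by simp
    then have "int (\<Sum>d\<in>I. leaf_gain K d) - int (\<Sum>d\<in>I. 2 * excess (dst d) d)
      \<le> int (\<Sum>d\<in>star K d0. leaf_gain K d) - int (\<Sum>d\<in>star K d0. 2 * excess (dst d) d)"
      by (simp add: sum_subtractf)
    then show "centre_gain K d0 + (\<Sum>d\<in>I. leaf_gain K d)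
        \<le> 2 * excess (src d0) d0 + (\<Sum>d\<in>I. 2 * excess (dst d) d)"
      using st unfolding stable_def gain_def loss_def by linarith
  qed
qed

lemma leaf_gain_antimono: "K \<subseteq> K' \<Longrightarrow> leaf_gain K' d \<le> leaf_gain K d"
  by (auto simp: leaf_gain_def)

lemma centre_gain_antimono: "K \<subseteq> K' \<Longrightarrow> centre_gain K' d \<le> centre_gain K d"
  by (auto simp: centre_gain_def)

text \<open>The chosen star changes with \<open>K\<close>, so two coverages are compared through the
  quantified form: for a fixed \<open>I\<close> the gains shrink as \<open>K\<close> grows, and the
  losses do not depend on \<open>K\<close>.\<close>

lemma stable_mono:
  assumes "stable K d0" "K \<subseteq> K'" "d0 \<in> D"
  shows "stable K' d0"
  unfolding stable_iff[OF assms(3)]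
proof (intro allI impI)
  fix I assume I: "d0 \<in> I" "I \<subseteq> darts_at (src d0)" "\<forall>d\<in>I. c d \<le> c d0"
  have "centre_gain K' d0 + (\<Sum>d\<in>I. leaf_gain K' d) \<le> centre_gain K d0 + (\<Sum>d\<in>I. leaf_gain K d)"
    by (intro add_mono sum_mono leaf_gain_antimono centre_gain_antimono assms)
  also have "\<dots> \<le> 2 * excess (src d0) d0 + (\<Sum>d\<in>I. 2 * excess (dst d) d)"
    using assms(1) I unfolding stable_iff[OF assms(3)] by blast
  finally show "centre_gain K' d0 + (\<Sum>d\<in>I. leaf_gain K' d)
    \<le> 2 * excess (src d0) d0 + (\<Sum>d\<in>I. 2 * excess (dst d) d)" .
qed

lemma step_mono: "K \<subseteq> fst (step d (K, S))"
  by (auto simp: step_def)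

text \<open>After a purchase the centre and the leaves of the star have no gain left, and the leaves
  that were left out were unprofitable already.\<close>

lemma stable_step:
  assumes "d0 \<in> D"
  shows "stable (fst (step d0 (K, S))) d0"
proof (cases "loss K d0 < gain K d0")
  case True
  define K' where "K' = fst (step d0 (K, S))"
  have K': "K' = K \<union> dst ` {d \<in> star K d0. late (dst d) d} \<union> (if late (src d0) d0 then {src d0} else {})"
    using True by (simp add: K'_def step_def)
  have "stable K' d0"
    unfolding stable_iff[OF assms]
  proof (intro allI impI add_mono sum_mono)
    show "centre_gain K' d0 \<le> 2 * excess (src d0) d0" by (simp add: centre_gain_def K')
    fix I d assume I: "d0 \<in> I" "I \<subseteq> darts_at (src d0)" "\<forall>d\<in>I. c d \<le> c d0" "d \<in> I"
    show "leaf_gain K' d \<le> 2 * excess (dst d) d"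
    proof (cases "d \<in> star K d0")
      case True
      then show ?thesis by (auto simp: leaf_gain_def K')
    next
      case False
      then have "leaf_gain K d \<le> 2 * excess (dst d) d"
        using I by (force simp: star_def darts_at_def)
      moreover have "leaf_gain K' d \<le> leaf_gain K d"
        by (rule leaf_gain_antimono) (auto simp: K')
      ultimately show ?thesis by simp
    qed
  qed
  then show ?thesis by (simp add: K'_def)
qed (simp add: step_def stable_def)

section \<open>Potential argument for the greedy pass\<close>

definition invariant :: "'v set \<Rightarrow> nat set \<Rightarrow> bool" where
  "invariant K S \<longleftrightarrow> early_edges \<subseteq> S \<and> S \<subseteq> ed ` D \<and>
     (\<forall>v\<in>K. \<exists>d\<in>darts_at v. ed d \<in> S \<and> late v d) \<and>
     (\<exists>L. (\<forall>v. base v \<le> L v) \<and>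
        (\<forall>d\<in>D. ed d \<in> S \<longrightarrow> ed d \<in> early_edges \<or> c d \<le> L (src d)) \<and>
        2 * sum L V + sum base (V - K) \<le> 3 * sum base V)"

lemma invariant_start: "invariant {} early_edges"
  unfolding invariant_def by (auto simp: early_edges_def intro!: exI[of _ base])

text \<open>No \<open>base\<close> value is counted twice: the graph is simple, so the leaves are
  distinct, and without loops the centre is not a leaf. The gain is thus really removed from the
  uncovered part.\<close>

lemma gain_le:
  assumes "d0 \<in> D"
  shows "gain K d0 \<le> sum base ((V - K) \<inter>
    (dst ` {d \<in> star K d0. late (dst d) d} \<union> (if late (src d0) d0 then {src d0} else {})))"
proof -
  let ?A = "if src d0 \<notin> K \<and> late (src d0) d0 then {src d0} else {}"
  let ?I = "{d \<in> star K d0. dst d \<notin> K \<and> late (dst d) d}"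
  have inj: "inj_on dst ?I"
    using inj_on_dst_darts_at by (rule inj_on_subset) (use star_subset[OF assms] in auto)
  have "(\<Sum>d\<in>star K d0. leaf_gain K d) = (\<Sum>d\<in>?I. base (dst d))"
    unfolding leaf_gain_def by (rule sum.inter_filter[symmetric]) simp
  also have "\<dots> = sum base (dst ` ?I)"
    using inj by (simp add: sum.reindex)
  finally have "gain K d0 = sum base ?A + sum base (dst ` ?I)"
    by (simp add: gain_def centre_gain_def)
  also have "\<dots> = sum base (?A \<union> dst ` ?I)"
  proof (rule sum.union_disjoint[symmetric])
    have "src d0 \<noteq> dst d" if "d \<in> star K d0" for d
      using that assms no_loop[of d] by (auto simp: star_def)
    then show "?A \<inter> dst ` ?I = {}" by auto
  qed auto
  also have "\<dots> \<le> sum base ((V - K) \<inter>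
    (dst ` {d \<in> star K d0. late (dst d) d} \<union> (if late (src d0) d0 then {src d0} else {})))"
    by (rule sum_mono2) (use assms in \<open>auto simp: star_def\<close>)
  finally show ?thesis .
qed

lemma invariant_step:
  assumes "invariant K S" "d0 \<in> D"
  shows "case step d0 (K, S) of (K', S') \<Rightarrow> invariant K' S'"
proof (cases "loss K d0 < gain K d0")
  case True
  let ?N = "dst ` {d \<in> star K d0. late (dst d) d} \<union> (if late (src d0) d0 then {src d0} else {})"
  from assms(1) obtain L where "\<forall>v. base v \<le> L v"
    "\<forall>d\<in>D. ed d \<in> S \<longrightarrow> ed d \<in> early_edges \<or> c d \<le> L (src d)"
    and L3: "2 * sum L V + sum base (V - K) \<le> 3 * sum base V"
    unfolding invariant_def by blast
  then have L: "base v \<le> L v" "d \<in> D \<Longrightarrow> ed d \<in> S \<Longrightarrow> ed d \<in> early_edges \<or> c d \<le> L (src d)"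
    for v d by auto
  \<comment> \<open>The centre rises by the excess of \<open>d0\<close> only, each leaf by the
    excess of its dart; together this is half the loss.\<close>
  define M where "M = (\<lambda>w. L w + (if w = src d0 then excess (src d0) d0 else 0)
    + (\<Sum>d | d \<in> star K d0 \<and> dst d = w. excess (dst d) d))"
  have "sum M V = sum L V + excess (src d0) d0 + (\<Sum>d\<in>star K d0. excess (dst d) d)"
    unfolding M_def sum.distrib using assms(2)
    by (subst sum.group) (auto simp: star_def)
  then have M_sum: "2 * sum M V = 2 * sum L V + loss K d0"
    by (simp add: loss_def sum_distrib_left)
  have M_base: "base v \<le> M v" for v using L(1)[of v] by (simp add: M_def)
  \<comment> \<open>A dart on a star edge starts at the centre, where \<open>d0\<close> dominates
    its cost, or at the leaf, where its own excess has been added.\<close>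
  have M_level: "c d \<le> M (src d)" if "d \<in> D" "x \<in> star K d0" "ed d = ed x" for d x
  proof -
    have x: "x \<in> D" "src x = src d0" "c x \<le> c d0" using that assms(2) by (auto simp: star_def)
    consider "d = x" | "d = mate x" using ed_eq[OF x(1) \<open>d \<in> D\<close> \<open>ed d = ed x\<close>[symmetric]] by blast
    then show ?thesis
    proof cases
      case 1
      have "c d0 \<le> base (src d0) + excess (src d0) d0" by (simp add: excess_def)
      also have "\<dots> \<le> M (src d0)" using L(1)[of "src d0"] by (simp add: M_def)
      finally show ?thesis using 1 x by simp
    next
      case 2
      have "excess (dst x) x \<le> (\<Sum>d | d \<in> star K d0 \<and> dst d = dst x. excess (dst d) d)"
        by (rule member_le_sum[of x _ "\<lambda>d. excess (dst d) d"]) (use that in auto)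
      moreover have "c x \<le> base (dst x) + excess (dst x) x" by (simp add: excess_def)
      ultimately have "c x \<le> M (dst x)" using L(1)[of "dst x"] by (simp add: M_def)
      then show ?thesis using 2 x by simp
    qed
  qed
  have "sum base (V - K) = sum base ((V - K) \<inter> ?N) + sum base ((V - K) - ?N)"
    by (rule sum.Int_Diff) simp
  also have "(V - K) - ?N = V - (K \<union> ?N)" by blast
  finally have M_pot: "2 * sum M V + sum base (V - (K \<union> ?N)) \<le> 3 * sum base V"
    using M_sum L3 True gain_le[OF assms(2), of K] by linarith
  have ed: "\<forall>d\<in>D. ed d \<in> S \<union> ed ` star K d0 \<longrightarrow> ed d \<in> early_edges \<or> c d \<le> M (src d)"
  proof (intro ballI impI)
    fix d assume "d \<in> D" "ed d \<in> S \<union> ed ` star K d0"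
    moreover have "L (src d) \<le> M (src d)" by (simp add: M_def)
    ultimately show "ed d \<in> early_edges \<or> c d \<le> M (src d)"
      using L(2)[of d] M_level[of d] by force
  qed
  have cov: "\<exists>d\<in>darts_at v. ed d \<in> S \<union> ed ` star K d0 \<and> late v d" if v: "v \<in> K \<union> ?N" for v
  proof -
    consider "v \<in> K" | d where "d \<in> star K d0" "late (dst d) d" "v = dst d"
      | "late (src d0) d0" "v = src d0"
      using v by (auto split: if_splits)
    then show ?thesis
    proof cases
      case 1
      then show ?thesis using assms(1) by (auto simp: invariant_def)
    next
      case 2
      then have "d \<in> D" by (simp add: star_def)
      with 2 show ?thesis by (intro bexI[of _ "mate d"]) (auto simp: darts_at_def)
    next
      case 3
      then show ?thesis using assms(2) by (intro bexI[of _ d0]) (auto simp: darts_at_def star_def)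
    qed
  qed
  have "invariant (K \<union> ?N) (S \<union> ed ` star K d0)"
    unfolding invariant_def
  proof (intro conjI ballI exI[of _ M] allI)
    show "early_edges \<subseteq> S \<union> ed ` star K d0" "S \<union> ed ` star K d0 \<subseteq> ed ` D"
      using assms(1) by (auto simp: invariant_def star_def)
  qed (use cov M_base ed M_pot in auto)
  moreover have "step d0 (K, S) = (K \<union> ?N, S \<union> ed ` star K d0)"
    using True by (simp add: step_def Un_assoc)
  ultimately show ?thesis by simp
qed (use assms in \<open>simp add: step_def\<close>)

lemma fold_step:
  assumes "invariant K S" "set ds \<subseteq> D" "fold step ds (K, S) = (K', S')"
  shows "invariant K' S' \<and> K \<subseteq> K' \<and> (\<forall>d\<in>set ds. stable K' d)"
  using assms
proof (induction ds arbitrary: K S)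
  case (Cons d ds)
  obtain K1 S1 where s: "step d (K, S) = (K1, S1)" by fastforce
  have "invariant K1 S1" "K \<subseteq> K1" "stable K1 d"
    using invariant_step[of K S d] step_mono[of K d S] stable_step[of d K S] Cons.prems s by auto
  with Cons.IH[of K1 S1] Cons.prems s show ?case using stable_mono[of K1 d K'] by auto
qed simp

lemma greedy_invariant:
  assumes "set ds = D" "greedy ds = (K, S)"
  shows "invariant K S" "d \<in> D \<Longrightarrow> stable K d"
  using fold_step[OF invariant_start, of ds K S] assms by (auto simp: greedy_def)

end

text \<open>Kept separate because the algorithm must also run, within its time bound, on instances
  without a solution; only its quality relies on sufficient degrees.\<close>

locale solvable_dart_graph = dart_graph +
  assumes enough: "v \<in> V \<Longrightarrow> r v \<le> card (darts_at v)"
begin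

section \<open>Early and late darts in feasible sets\<close>

lemma base_dart:
  assumes "v \<in> V" "0 < r v"
  obtains d where "d \<in> darts_at v" "rk v d + 1 = r v" "base v = c d"
proof -
  have "r v - 1 \<in> rk v ` darts_at v"
    using assms enough[of v] bij_betw_rk[of v] by (auto simp: bij_betw_def)
  then obtain d where "d \<in> darts_at v" "rk v d = r v - 1" by auto
  with assms that base_eq[of d v] show ?thesis by auto
qed

lemma cost_le_base:
  assumes "d \<in> darts_at v" "rk v d + 1 \<le> r v"
  shows "c d \<le> base v"
proof -
  have "v \<in> V" using assms by (auto simp: darts_at_def)
  then obtain d' where "d' \<in> darts_at v" "rk v d' + 1 = r v" "base v = c d'"
    using base_dart assms by (metis add_gr_0 less_le_trans zero_less_one)
  then show ?thesis using assms cost_mono_rk[of d v d'] by simp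
qed

lemma base_le_cost:
  assumes "d \<in> darts_at v" "late v d"
  shows "base v \<le> c d"
proof (cases "r v = 0")
  case False
  have "v \<in> V" using assms by (auto simp: darts_at_def)
  then obtain d' where "d' \<in> darts_at v" "rk v d' + 1 = r v" "base v = c d'"
    using base_dart False by blast
  then show ?thesis using assms cost_mono_rk[of d' v d] by (simp add: late_def)
qed (simp add: base_0)

lemma heavy_late:
  assumes "d \<in> darts_at v" "base v < c d"
  shows "late v d"
  using cost_le_base[OF assms(1)] assms(2) by (force simp: late_def)

text \<open>Pigeonhole: only \<open>r v - 1\<close> darts at \<open>v\<close> are early.\<close>

lemma feasible_late:
  assumes "feasible S" "v \<in> V" "0 < r v"
  shows "\<exists>d\<in>darts_at v. ed d \<in> S \<and> late v d"
proof (rule ccontr)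
  assume "\<not> ?thesis"
  then have "{d \<in> darts_at v. ed d \<in> S} \<subseteq> {d \<in> darts_at v. rk v d + 1 < r v}"
    by (auto simp: late_def)
  then have "card {d \<in> darts_at v. ed d \<in> S} \<le> r v - 1"
    using card_mono[of "{d \<in> darts_at v. rk v d + 1 < r v}"] card_early[OF enough[OF assms(2)]]
    by auto
  then show False using assms by (force simp: feasible_def)
qed

text \<open>The \<open>r v - 1\<close> early darts and one late dart are \<open>r v\<close>
  different darts. Once the early edges are bought, feasibility is therefore the task of covering
  each vertex once.\<close>

lemma feasibleI:
  assumes "early_edges \<subseteq> S" "\<And>v. v \<in> V \<Longrightarrow> 0 < r v \<Longrightarrow> \<exists>d\<in>darts_at v. ed d \<in> S \<and> late v d"
  shows "feasible S"
  unfolding feasible_def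
proof
  fix v assume v: "v \<in> V"
  show "r v \<le> card {d \<in> darts_at v. ed d \<in> S}"
  proof (cases "r v = 0")
    case False
    then obtain d where d: "d \<in> darts_at v" "ed d \<in> S" "late v d" using assms(2) v by blast
    let ?E = "{d \<in> darts_at v. rk v d + 1 < r v}"
    have "insert d ?E \<subseteq> {d \<in> darts_at v. ed d \<in> S}"
      using d subsetD[OF assms(1)] by (fastforce simp: early_edges_def darts_at_def)
    then have "card (insert d ?E) \<le> card {d \<in> darts_at v. ed d \<in> S}"
      by (rule card_mono[rotated]) simp
    moreover have "card (insert d ?E) = Suc (r v - 1)"
      using d card_early[OF enough[OF v]] by (simp add: late_def)
    ultimately show ?thesis by simp
  qed simp
qed

text \<open>A solution has a late dart at \<open>v\<close>, and that dart costs at least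
  \<open>base v\<close>: the elementary lower bound on the optimum.\<close>

lemma base_le_level:
  assumes "feasible S" "\<And>d. d \<in> D \<Longrightarrow> ed d \<in> S \<Longrightarrow> c d \<le> L (src d)" "v \<in> V"
  shows "base v \<le> (L v :: nat)"
proof (cases "r v = 0")
  case False
  then obtain d where "d \<in> darts_at v" "ed d \<in> S" "late v d"
    using feasible_late assms by blast
  then show ?thesis using base_le_cost[of d v] assms(2)[of d] by (auto simp: darts_at_def)
qed (simp add: base_0)

section \<open>Decomposition of a solution into stars\<close>

lemma minimal_cover:
  assumes "feasible O'" "finite O'"
  obtains E where "E \<subseteq> O'"
    "\<And>v. v \<in> V \<Longrightarrow> 0 < r v \<Longrightarrow> \<exists>d\<in>darts_at v. ed d \<in> E \<and> late v d"
    "\<And>i. i \<in> E \<Longrightarrow> \<exists>v\<in>V. 0 < r v \<and> (\<exists>d\<in>darts_at v. ed d = i \<and> late v d) \<and>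
       (\<forall>d\<in>darts_at v. ed d \<in> E \<and> late v d \<longrightarrow> ed d = i)"
proof -
  define cov where "cov E \<longleftrightarrow> (\<forall>v\<in>V. 0 < r v \<longrightarrow> (\<exists>d\<in>darts_at v. ed d \<in> E \<and> late v d))" for E
  have "cov O'" using feasible_late[OF assms(1)] by (simp add: cov_def)
  with assms(2) obtain E where E: "E \<subseteq> O'" "cov E" "\<And>E'. E' \<subseteq> E \<Longrightarrow> cov E' \<Longrightarrow> E' = E"
    using finite_has_minimal2[of "{E. E \<subseteq> O' \<and> cov E}" O'] by (auto dest: subset_trans)
  show thesis
  proof (rule that[OF E(1)])
    fix i assume i: "i \<in> E"
    \<comment> \<open>By minimality, dropping \<open>i\<close> uncovers some vertex, so
      \<open>i\<close> is the only late edge of \<open>E\<close> there. This private vertex will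
      become the head of the edge.\<close>
    then have "\<not> cov (E - {i})" using E(3)[of "E - {i}"] by auto
    then obtain v where v: "v \<in> V" "0 < r v" "\<And>d. d \<in> darts_at v \<Longrightarrow> ed d \<in> E - {i} \<Longrightarrow> \<not> late v d"
      unfolding cov_def by blast
    moreover obtain d where "d \<in> darts_at v" "ed d \<in> E" "late v d"
      using E(2) v(1,2) unfolding cov_def by blast
    ultimately show "\<exists>v\<in>V. 0 < r v \<and> (\<exists>d\<in>darts_at v. ed d = i \<and> late v d) \<and>
       (\<forall>d\<in>darts_at v. ed d \<in> E \<and> late v d \<longrightarrow> ed d = i)" by blast
  qed (use E(2) in \<open>auto simp: cov_def\<close>)
qed

text \<open>The stars come from a minimal set of edges that covers every vertex beyond its early edges. As
  each edge is directed to a vertex that needs it, no vertex pays an excess both as a centre and as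
  a leaf.\<close>

lemma star_decomposition:
  assumes "feasible S" "S \<subseteq> ed ` D"
  obtains Q where "Q \<subseteq> D" "\<And>q. q \<in> Q \<Longrightarrow> ed q \<in> S"
    "inj_on dst Q"
    "\<And>v. v \<in> V \<Longrightarrow> 0 < r v \<Longrightarrow>
       (\<exists>q\<in>Q. src q = v \<and> late v q) \<or> (\<exists>q\<in>Q. dst q = v \<and> late v q)"
    "\<And>p q. p \<in> Q \<Longrightarrow> q \<in> Q \<Longrightarrow> base (src p) < c p \<Longrightarrow> dst q \<noteq> src p"
proof -
  have "finite S" using assms(2) finite_D finite_subset by blast
  then obtain E where E: "E \<subseteq> S"
    "\<And>v. v \<in> V \<Longrightarrow> 0 < r v \<Longrightarrow> \<exists>d\<in>darts_at v. ed d \<in> E \<and> late v d"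
    "\<And>i. i \<in> E \<Longrightarrow> \<exists>v\<in>V. 0 < r v \<and> (\<exists>d\<in>darts_at v. ed d = i \<and> late v d) \<and>
       (\<forall>d\<in>darts_at v. ed d \<in> E \<and> late v d \<longrightarrow> ed d = i)"
    by (rule minimal_cover[OF assms(1)]) blast
  \<comment> \<open>Each edge is directed towards its private vertex, hence the mate of the dart
    found there.\<close>
  have "\<exists>q\<in>D. ed q = i \<and> late (dst q) q \<and> (\<forall>d\<in>darts_at (dst q). ed d \<in> E \<and> late (dst q) d \<longrightarrow> ed d = i)"
    if "i \<in> E" for i
  proof -
    from E(3)[OF that] obtain v d where d: "d \<in> darts_at v" "ed d = i" "late v d"
      "\<forall>d\<in>darts_at v. ed d \<in> E \<and> late v d \<longrightarrow> ed d = i" by blast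
    then show ?thesis by (intro bexI[of _ "mate d"]) (auto simp: darts_at_def)
  qed
  then obtain f where f: "\<And>i. i \<in> E \<Longrightarrow> f i \<in> D" "\<And>i. i \<in> E \<Longrightarrow> ed (f i) = i"
    "\<And>i. i \<in> E \<Longrightarrow> late (dst (f i)) (f i)"
    "\<And>i d. i \<in> E \<Longrightarrow> d \<in> darts_at (dst (f i)) \<Longrightarrow> ed d \<in> E \<Longrightarrow> late (dst (f i)) d \<Longrightarrow> ed d = i"
    by metis
  have unique: "d = mate (f i)" if "i \<in> E" "d \<in> darts_at (dst (f i))" "ed d \<in> E" "late (dst (f i)) d" for i d
    using f(4)[OF that] f(1,2)[OF that(1)] ed_eq[of "f i" d] that no_loop[of "f i"]
    by (auto simp: darts_at_def)
  show thesis
  proof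
    show "f ` E \<subseteq> D" using f(1) by auto
    show "inj_on dst (f ` E)"
    proof (rule inj_onI)
      fix p q assume "p \<in> f ` E" "q \<in> f ` E" "dst p = dst q"
      then obtain i j where ij: "i \<in> E" "j \<in> E" "p = f i" "q = f j" "dst (f i) = dst (f j)" by auto
      then have "mate (f j) \<in> darts_at (dst (f i))" "late (dst (f i)) (mate (f j))"
        using f(1,3)[of j] by (auto simp: darts_at_def)
      then have "ed (mate (f j)) = i" using f(1,2)[of j] f(4)[of i "mate (f j)"] ij by simp
      then show "p = q" using f(1,2)[of j] ij by simp
    qed
    show "ed q \<in> S" if "q \<in> f ` E" for q using that f(2) E(1) by auto
    show "(\<exists>q\<in>f ` E. src q = v \<and> late v q) \<or> (\<exists>q\<in>f ` E. dst q = v \<and> late v q)"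
      if v: "v \<in> V" "0 < r v" for v
    proof -
      obtain d where d: "d \<in> darts_at v" "ed d \<in> E" "late v d" using E(2)[OF v] by blast
      let ?q = "f (ed d)"
      have "d = ?q \<or> d = mate ?q"
        using ed_eq[of ?q d] f(1,2)[OF d(2)] d(1) by (auto simp: darts_at_def)
      moreover have "?q \<in> f ` E" "?q \<in> D" using d(2) f(1) by auto
      moreover have "src d = v" "late v ?q = late v d"
        using d(1) calculation by (auto simp: darts_at_def)
      ultimately show ?thesis using d(3) by (metis src_mate)
    qed
    \<comment> \<open>A dart \<open>p\<close> dearer than \<open>base\<close> is late at its source.
      If \<open>q\<close> ended there, that vertex would be private to the edge of \<open>q\<close>,
      so \<open>p\<close> would be \<open>q\<close> reversed; but each edge is directed only
      once.\<close>
    show "dst q \<noteq> src p" if pq: "p \<in> f ` E" "q \<in> f ` E" "base (src p) < c p" for p q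
    proof
      assume eq: "dst q = src p"
      obtain i j where ij: "i \<in> E" "j \<in> E" "p = f i" "q = f j" using pq by auto
      have "p \<in> darts_at (dst q)" using eq ij f(1) by (auto simp: darts_at_def)
      moreover have "late (dst q) p" using heavy_late calculation pq(3) eq by simp
      ultimately have "p = mate q" using unique[of j p] ij f(2) by simp
      then have "i = j" using f(1,2) ij by (metis ed_mate)
      then show False using ij eq no_loop[of p] f(1) by simp
    qed
  qed
qed

lemma uncovered_le:
  assumes "feasible S" "S \<subseteq> ed ` D" "\<And>d. d \<in> D \<Longrightarrow> ed d \<in> S \<Longrightarrow> c d \<le> L (src d)"
    and stable: "\<And>d. d \<in> D \<Longrightarrow> stable K d"
  shows "sum base (V - K) + 2 * sum base V \<le> 2 * sum L V"
proof -
  obtain Q where Q: "Q \<subseteq> D" "\<And>q. q \<in> Q \<Longrightarrow> ed q \<in> S"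
    and inj: "inj_on dst Q"
    and cov: "\<And>v. v \<in> V \<Longrightarrow> 0 < r v \<Longrightarrow>
       (\<exists>q\<in>Q. src q = v \<and> late v q) \<or> (\<exists>q\<in>Q. dst q = v \<and> late v q)"
    and heavy: "\<And>p q. p \<in> Q \<Longrightarrow> q \<in> Q \<Longrightarrow> base (src p) < c p \<Longrightarrow> dst q \<noteq> src p"
    by (rule star_decomposition[OF assms(1,2)]) blast
  have fin [simp]: "finite Q" using Q(1) finite_D by (rule finite_subset)
  define Qv where "Qv v = {q \<in> Q. src q = v}" for v
  have Qv: "finite (Qv v)" "Qv v \<subseteq> darts_at v" "Qv v \<subseteq> D" for v
    using Q(1) by (auto simp: Qv_def darts_at_def)
  \<comment> \<open>\<open>X v\<close> is what \<open>v\<close> pays as a centre, with 0 if no dart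
    of \<open>Q\<close> starts there; \<open>Y v\<close> is what it pays as a leaf, and
    \<open>A v\<close> is what it gains as a centre.\<close>
  define X where "X v = Max (insert 0 (excess v ` Qv v))" for v
  define Y where "Y v = (\<Sum>q | q \<in> Q \<and> dst q = v. excess (dst q) q)" for v
  define A where "A v = (if v \<notin> K \<and> (\<exists>q\<in>Qv v. late v q) then base v else 0)" for v
  have centre: "A v + (\<Sum>q\<in>Qv v. leaf_gain K q) \<le> 2 * X v + (\<Sum>q\<in>Qv v. 2 * excess (dst q) q)" for v
  proof (cases "\<exists>q\<in>Qv v. base v < c q")
    case True
    then have ne: "Qv v \<noteq> {}" by auto
    \<comment> \<open>The dearest dart plays the role of \<open>d0\<close>. Exceeding
      \<open>base v\<close>, it is late, so its star credits the centre as well.\<close>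
    then have "Max (c ` Qv v) \<in> c ` Qv v" using Qv by simp
    then obtain d where d: "d \<in> Qv v" "c d = Max (c ` Qv v)" by auto
    then have max: "\<forall>q\<in>Qv v. c q \<le> c d" using Qv by simp
    have dD: "d \<in> D" "src d = v" using d Qv by (auto simp: Qv_def)
    have "late v d" using heavy_late[of d v] True max d Qv(2)[of v] by fastforce
    moreover have "centre_gain K d + (\<Sum>q\<in>Qv v. leaf_gain K q)
      \<le> 2 * excess (src d) d + (\<Sum>q\<in>Qv v. 2 * excess (dst q) q)"
      using stable[OF dD(1)] Qv(2)[of v] max d(1) dD(2) unfolding stable_iff[OF dD(1)] by simp
    moreover have "excess v d \<le> X v" unfolding X_def using d Qv by (intro Max_ge) auto
    moreover have "A v \<le> base v" "v \<in> K \<Longrightarrow> A v = 0" by (auto simp: A_def)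
    ultimately show ?thesis using dD by (force simp: centre_gain_def split: if_splits)
  next
    case False
    \<comment> \<open>Here no dart costs the centre any excess, so each one may serve as a star of
      its own. A dearest dart could be early, tied with \<open>base v\<close>, and the star built on
      it would then not credit the centre.\<close>
    have single: "centre_gain K q + leaf_gain K q \<le> 2 * excess (dst q) q" if "q \<in> Qv v" for q
    proof -
      have q: "q \<in> D" "src q = v" "excess v q = 0"
        using that Qv False by (auto simp: Qv_def excess_def)
      have "q \<in> {q} \<longrightarrow> {q} \<subseteq> darts_at (src q) \<longrightarrow> (\<forall>d\<in>{q}. c d \<le> c q) \<longrightarrow>
        centre_gain K q + (\<Sum>d\<in>{q}. leaf_gain K d) \<le> 2 * excess (src q) q + (\<Sum>d\<in>{q}. 2 * excess (dst d) d)"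
        using stable[OF q(1)] unfolding stable_iff[OF q(1)] by blast
      then show ?thesis using q by (simp add: darts_at_def)
    qed
    have "A v \<le> (\<Sum>q\<in>Qv v. centre_gain K q)"
    proof (cases "v \<notin> K \<and> (\<exists>q\<in>Qv v. late v q)")
      case True
      then obtain q where q: "q \<in> Qv v" "late v q" by blast
      have "A v = centre_gain K q" using True q by (auto simp: A_def centre_gain_def Qv_def)
      also have "\<dots> \<le> (\<Sum>q\<in>Qv v. centre_gain K q)"
        by (rule member_le_sum) (use q Qv in auto)
      finally show ?thesis .
    qed (auto simp: A_def)
    then have "A v + (\<Sum>q\<in>Qv v. leaf_gain K q) \<le> (\<Sum>q\<in>Qv v. centre_gain K q + leaf_gain K q)"
      by (simp add: sum.distrib)
    also have "\<dots> \<le> (\<Sum>q\<in>Qv v. 2 * excess (dst q) q)"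
      by (rule sum_mono) (rule single)
    finally show ?thesis by simp
  qed
  \<comment> \<open>\<open>X v\<close> and \<open>Y v\<close> are never both positive: a vertex that
    pays an excess as a centre receives no dart. Otherwise it receives at most one dart, whose cost
    is below \<open>L v\<close>.\<close>
  have level: "base v + (X v + Y v) \<le> L v" if v: "v \<in> V" for v
  proof (cases "X v = 0")
    case True
    have bl: "base v \<le> L v" using base_le_level[OF assms(1) assms(3) v] by simp
    show ?thesis
    proof (cases "\<exists>q\<in>Q. dst q = v")
      case t: True
      then obtain q where q: "q \<in> Q" "dst q = v" by blast
      then have "{q \<in> Q. dst q = v} = {q}" using inj by (auto dest: inj_onD)
      then have "Y v = excess v q" using q by (simp add: Y_def)
      moreover have "c q \<le> L v" using assms(3)[of "mate q"] q Q by auto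
      ultimately show ?thesis using True bl by (simp add: excess_def)
    next
      case False
      then have "{q \<in> Q. dst q = v} = {}" by blast
      then have "Y v = 0" by (simp only: Y_def sum.empty)
      then show ?thesis using True bl by simp
    qed
  next
    case False
    have "X v \<in> insert 0 (excess v ` Qv v)" unfolding X_def by (rule Max_in) (use Qv in auto)
    then obtain p where p: "p \<in> Qv v" "X v = excess v p" using False by auto
    then have p': "p \<in> Q" "src p = v" "base v < c p" using False by (auto simp: Qv_def excess_def)
    then have "{q \<in> Q. dst q = v} = {}" using heavy[of p] by auto
    then have "Y v = 0" by (simp only: Y_def sum.empty)
    moreover have "c p \<le> L v" using assms(3)[of p] p' Q by auto
    ultimately show ?thesis using p p' by (simp add: excess_def)
  qed
  have "sum base (V - K) \<le> (\<Sum>v\<in>V. A v + (\<Sum>q | q \<in> Q \<and> dst q = v. leaf_gain K q))"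
  proof -
    have "base v \<le> A v + (\<Sum>q | q \<in> Q \<and> dst q = v. leaf_gain K q)" if v: "v \<in> V - K" for v
    proof (cases "r v = 0")
      case False
      with cov[of v] v consider q where "q \<in> Q" "src q = v" "late v q"
        | q where "q \<in> Q" "dst q = v" "late v q" by blast
      then show ?thesis
      proof cases
        case 1
        then have "A v = base v" using v by (auto simp: A_def Qv_def)
        then show ?thesis by simp
      next
        case 2
        then have "leaf_gain K q = base v" using v by (simp add: leaf_gain_def)
        moreover have "leaf_gain K q \<le> (\<Sum>q | q \<in> Q \<and> dst q = v. leaf_gain K q)"
          by (rule member_le_sum) (use 2 in auto)
        ultimately show ?thesis by simp
      qed
    qed (simp add: base_0)
    then have "sum base (V - K) \<le> (\<Sum>v\<in>V - K. A v + (\<Sum>q | q \<in> Q \<and> dst q = v. leaf_gain K q))"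
      by (rule sum_mono)
    also have "\<dots> \<le> (\<Sum>v\<in>V. A v + (\<Sum>q | q \<in> Q \<and> dst q = v. leaf_gain K q))"
      by (rule sum_mono2) auto
    finally show ?thesis .
  qed
  \<comment> \<open>Leaf gains are regrouped by centre so that \<open>centre\<close> applies;
    afterwards the excesses are regrouped by leaf.\<close>
  also have "\<dots> = sum A V + (\<Sum>q\<in>Q. leaf_gain K q)"
    unfolding sum.distrib using Q(1) by (subst sum.group) auto
  also have "\<dots> = (\<Sum>v\<in>V. A v + (\<Sum>q\<in>Qv v. leaf_gain K q))"
    unfolding sum.distrib Qv_def using Q(1) by (subst sum.group) auto
  also have "\<dots> \<le> (\<Sum>v\<in>V. 2 * X v + (\<Sum>q\<in>Qv v. 2 * excess (dst q) q))"
    by (rule sum_mono) (rule centre)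
  also have "\<dots> = (\<Sum>v\<in>V. 2 * X v) + (\<Sum>q\<in>Q. 2 * excess (dst q) q)"
    unfolding sum.distrib Qv_def using Q(1) by (subst sum.group) auto
  also have "\<dots> = (\<Sum>v\<in>V. 2 * X v) + (\<Sum>v\<in>V. 2 * Y v)"
    unfolding Y_def sum_distrib_left using Q(1) by (subst sum.group) auto
  finally have "sum base (V - K) + 2 * sum base V \<le> 2 * (\<Sum>v\<in>V. base v + (X v + Y v))"
    by (simp add: sum.distrib sum_distrib_left)
  also have "\<dots> \<le> 2 * sum L V" using sum_mono[of V, OF level] by simp
  finally show ?thesis .
qed

section \<open>Approximation guarantee in terms of levels\<close>

theorem chosen_feasible:
  assumes "set ds = D"
  shows "feasible (chosen ds)"
proof -
  obtain K S where g: "greedy ds = (K, S)" by fastforce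
  note inv = greedy_invariant(1)[OF assms g]
  show ?thesis
  proof (rule feasibleI)
    show "early_edges \<subseteq> chosen ds" using inv by (auto simp: chosen_def g invariant_def)
    fix v assume v: "v \<in> V" "0 < r v"
    show "\<exists>d\<in>darts_at v. ed d \<in> chosen ds \<and> late v d"
    proof (cases "v \<in> K")
      case True
      then show ?thesis using inv by (auto simp: chosen_def g invariant_def)
    next
      case False
      obtain d where "d \<in> darts_at v" "rk v d + 1 = r v" using base_dart[OF v] by blast
      then show ?thesis using False
        by (intro bexI[of _ d]) (auto simp: chosen_def g fallback_def late_def darts_at_def)
    qed
  qed
qed

text \<open>Levels stand for powers on both sides, and doubling keeps the factor
  \<open>k + 1/2\<close> integral.\<close>

theorem chosen_level:
  assumes "set ds = D" "feasible S" "S \<subseteq> ed ` D"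
    and "\<And>d. d \<in> D \<Longrightarrow> ed d \<in> S \<Longrightarrow> c d \<le> L (src d)" and k: "\<And>v. v \<in> V \<Longrightarrow> r v \<le> k"
  obtains M where "\<And>d. d \<in> D \<Longrightarrow> ed d \<in> chosen ds \<Longrightarrow> c d \<le> M (src d)"
    "2 * sum M V \<le> (2 * k + 1) * sum L V"
proof -
  obtain K T where g: "greedy ds = (K, T)" by fastforce
  obtain N where "\<forall>v. base v \<le> N v"
    "\<forall>d\<in>D. ed d \<in> T \<longrightarrow> ed d \<in> early_edges \<or> c d \<le> N (src d)"
    and N3: "2 * sum N V + sum base (V - K) \<le> 3 * sum base V"
    using greedy_invariant(1)[OF assms(1) g] unfolding invariant_def by blast
  then have N: "base v \<le> N v" "d \<in> D \<Longrightarrow> ed d \<in> T \<Longrightarrow> ed d \<in> early_edges \<or> c d \<le> N (src d)"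
    for v d by auto
  have unc: "sum base (V - K) + 2 * sum base V \<le> 2 * sum L V"
    using uncovered_le[OF assms(2-4)] greedy_invariant(2)[OF assms(1) g] by blast
  define F where "F = {d \<in> D. rk (src d) d + 1 < r (src d)}"
  define R where "R = {d \<in> D. rk (src d) d + 1 = r (src d) \<and> src d \<notin> K}"
  have FR: "finite F" "finite R" "F \<subseteq> D" "R \<subseteq> D" by (auto simp: F_def R_def)
  \<comment> \<open>An early or fallback dart costs at most \<open>base\<close> at its own source,
    which \<open>N\<close> already pays. It is charged in full only at its other end.\<close>
  define M where "M v = N v + (\<Sum>d | d \<in> F \<and> dst d = v. c d) + (\<Sum>d | d \<in> R \<and> dst d = v. c d)" for v
  have M: "c d \<le> M (src d)" if d: "d \<in> D" "ed d \<in> ed ` (F \<union> R)" for d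
  proof -
    obtain x where x: "x \<in> F \<union> R" "ed d = ed x" using d by auto
    then have xD: "x \<in> D" "rk (src x) x + 1 \<le> r (src x)" by (auto simp: F_def R_def)
    consider "d = x" | "d = mate x" using ed_eq[of x d] xD(1) d(1) x(2) by auto
    then show ?thesis
    proof cases
      case 1
      have "c x \<le> base (src x)" using cost_le_base[of x "src x"] xD by (simp add: darts_at_def)
      also have "\<dots> \<le> M (src x)" using N(1)[of "src x"] by (simp add: M_def)
      finally show ?thesis using 1 by simp
    next
      case 2
      have "x \<in> F \<Longrightarrow> c x \<le> (\<Sum>d | d \<in> F \<and> dst d = dst x. c d)"
        by (rule member_le_sum) (use FR in auto)
      moreover have "x \<in> R \<Longrightarrow> c x \<le> (\<Sum>d | d \<in> R \<and> dst d = dst x. c d)"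
        by (rule member_le_sum) (use FR in auto)
      ultimately have "c x \<le> M (dst x)" using x by (auto simp: M_def)
      then show ?thesis using 2 xD by simp
    qed
  qed
  \<comment> \<open>Each vertex has \<open>r v - 1\<close> early darts of cost at most
    \<open>base v\<close>; the summand \<open>sum base V\<close> on the left avoids a truncated
    \<open>k - 1\<close>.\<close>
  have sumF: "sum c F + sum base V \<le> k * sum base V"
  proof -
    have "(\<Sum>d | d \<in> F \<and> src d = v. c d) + base v \<le> k * base v" if v: "v \<in> V" for v
    proof (cases "r v = 0")
      case False
      have eq: "{d \<in> F. src d = v} = {d \<in> darts_at v. rk v d + 1 < r v}"
        by (auto simp: F_def darts_at_def)
      have "(\<Sum>d | d \<in> F \<and> src d = v. c d) \<le> of_nat (card {d \<in> F. src d = v}) * base v"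
        by (rule sum_bounded_above) (auto simp: eq intro!: cost_le_base)
      also have "card {d \<in> F. src d = v} = r v - 1"
        unfolding eq by (rule card_early[OF enough[OF v]])
      finally have "(\<Sum>d | d \<in> F \<and> src d = v. c d) + base v \<le> (r v - 1) * base v + base v" by simp
      also have "\<dots> = r v * base v" using False by (cases "r v") auto
      also have "\<dots> \<le> k * base v" using k[OF v] by simp
      finally show ?thesis .
    next
      case True
      then have "{d \<in> F. src d = v} = {}" by (auto simp: F_def)
      then show ?thesis using True by (simp only: sum.empty base_0)
    qed
    then have "(\<Sum>v\<in>V. (\<Sum>d | d \<in> F \<and> src d = v. c d) + base v) \<le> (\<Sum>v\<in>V. k * base v)"
      by (rule sum_mono)
    moreover have "(\<Sum>v\<in>V. \<Sum>d | d \<in> F \<and> src d = v. c d) = sum c F"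
      by (rule sum.group) (use FR in auto)
    ultimately show ?thesis by (simp add: sum.distrib sum_distrib_left)
  qed
  have sumR: "sum c R \<le> sum base (V - K)"
  proof -
    have "sum c R = (\<Sum>d\<in>R. base (src d))"
      by (rule sum.cong) (auto simp: R_def darts_at_def intro!: base_eq[symmetric])
    \<comment> \<open>Ranks are injective at a vertex, so each uncovered vertex has at most one
      fallback dart.\<close>
    also have "inj_on src R"
    proof (rule inj_onI)
      fix d d' assume "d \<in> R" "d' \<in> R" "src d = src d'"
      then show "d = d'"
        using inj_onD[OF inj_on_rk[of "src d"], of d d'] by (auto simp: R_def darts_at_def)
    qed
    then have "(\<Sum>d\<in>R. base (src d)) = sum base (src ` R)" by (simp add: sum.reindex)
    also have "\<dots> \<le> sum base (V - K)"
      by (rule sum_mono2) (auto simp: R_def)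
    finally show ?thesis .
  qed
  have M_sum: "sum M V = sum N V + sum c F + sum c R"
  proof -
    have "(\<Sum>v\<in>V. \<Sum>d | d \<in> F \<and> dst d = v. c d) = sum c F"
      by (rule sum.group) (use FR in auto)
    moreover have "(\<Sum>v\<in>V. \<Sum>d | d \<in> R \<and> dst d = v. c d) = sum c R"
      by (rule sum.group) (use FR in auto)
    ultimately show ?thesis by (simp add: M_def sum.distrib)
  qed
  show thesis
  proof
    show "c d \<le> M (src d)" if d: "d \<in> D" "ed d \<in> chosen ds" for d
    proof -
      consider "ed d \<in> T" "ed d \<notin> early_edges" | "ed d \<in> early_edges \<union> fallback K"
        using d(2) by (auto simp: chosen_def g)
      then show ?thesis
      proof cases
        case 1
        then have "c d \<le> N (src d)" using N(2) d(1) by blast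
        then show ?thesis by (simp add: M_def)
      next
        case 2
        then have "ed d \<in> ed ` (F \<union> R)" by (auto simp: early_edges_def fallback_def F_def R_def)
        then show ?thesis using M d(1) by blast
      qed
    qed
    have "sum base V \<le> sum L V"
      by (rule sum_mono) (rule base_le_level[OF assms(2,4)])
    then have "k * sum base V \<le> k * sum L V" by simp
    moreover have "sum base (V - K) \<le> sum base V" by (rule sum_mono2) auto
    ultimately show "2 * sum M V \<le> (2 * k + 1) * sum L V"
    proof (cases k)
      \<comment> \<open>\<open>sumF\<close> makes \<open>sum base V\<close> and
        \<open>sum c F\<close> vanish, and everything else is bounded by
        \<open>sum base V\<close>.\<close>
      case 0
      then have "sum M V = 0"
        using M_sum N3 sumF sumR \<open>sum base (V - K) \<le> sum base V\<close> by simp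
      then show ?thesis by simp
    next
      case (Suc j)
      have "j * sum base V \<le> j * sum L V" using \<open>sum base V \<le> sum L V\<close> by simp
      moreover have "sum c F \<le> j * sum base V" using sumF Suc by simp
      \<comment> \<open>With \<open>b = sum base V\<close> and \<open>y = sum base (V - K)\<close>
        the left side is at most \<open>3 * b + y + 2 * j * b\<close>, and \<open>unc\<close> trades
        \<open>y\<close> for \<open>2 * sum L V - 2 * b\<close>.\<close>
      ultimately have "2 * sum M V \<le> 3 * sum L V + 2 * (j * sum L V)"
        using M_sum N3 sumR unc \<open>sum base V \<le> sum L V\<close> by linarith
      then show ?thesis using Suc by (simp add: algebra_simps)
    qed
  qed
qed
end

section \<open>A loop language and its running time\<close>

text \<open>A structured language whose loops run a number of times that is read off the input, so that
  programs have a total semantics by recursion and a syntactic polynomial time bound.\<close>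

datatype com =
    Nop
  | Assign string expr expr
  | Then com com (infixr \<open>;;\<close> 60)
  | Branch expr com com
  | For string expr com
  | Times string expr

abbreviation Var :: "string \<Rightarrow> expr" where
  "Var x \<equiv> Cell x (Num 0)"

text \<open>Scalar variables are cell 0 of an array of that name.\<close>

definition put :: "string \<Rightarrow> nat \<Rightarrow> memory \<Rightarrow> memory" where
  "put x v s = s(x := (s x)(0 := v))"

abbreviation mult_a :: string where "mult_a \<equiv> ''p''"
abbreviation mult_b :: string where "mult_b \<equiv> ''q''"

text \<open>Binary multiplication, since the machine has no product; subtracting twice the half
  isolates the lowest bit.\<close>

definition mult_body :: "string \<Rightarrow> prog" where
  "mult_body x =
     Seq (Cond (Sub (Var mult_b) (Add (Half (Var mult_b)) (Half (Var mult_b))))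
            (Store x (Num 0) (Add (Var x) (Var mult_a))) Skip)
       (Seq (Store mult_a (Num 0) (Add (Var mult_a) (Var mult_a)))
          (Store mult_b (Num 0) (Half (Var mult_b))))"

primrec compile :: "com \<Rightarrow> prog" where
  "compile Nop = Skip"
| "compile (Assign a e f) = Store a e f"
| "compile (p ;; q) = Seq (compile p) (compile q)"
| "compile (Branch e p q) = Cond e (compile p) (compile q)"
| "compile (For x e p) = Seq (Store x (Num 0) (Num 0))
     (While (Sub e (Var x)) (Seq (compile p) (Store x (Num 0) (Add (Var x) (Num 1)))))"
| "compile (Times x e) = Seq (Store mult_b (Num 0) e) (Seq (Store mult_a (Num 0) (Var x))
     (Seq (Store x (Num 0) (Num 0)) (Seq (While (Var mult_b) (mult_body x))
       (Store mult_a (Num 0) (Num 0)))))"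

text \<open>\<open>For\<close> evaluates its bound once, the compiled loop in every round;
  \<open>wf_com\<close> makes the two agree. \<open>Times\<close> leaves both scratch cells at 0, so
  its effect does not depend on the number of doublings.\<close>

primrec sem :: "com \<Rightarrow> memory \<Rightarrow> memory" where
  "sem Nop s = s"
| "sem (Assign a e f) s = s(a := (s a)(expr_val e s := expr_val f s))"
| "sem (p ;; q) s = sem q (sem p s)"
| "sem (Branch e p q) s = (if expr_val e s \<noteq> 0 then sem p s else sem q s)"
| "sem (For x e p) s = rec_nat (put x 0 s) (\<lambda>k s'. put x (Suc k) (sem p s')) (expr_val e s)"
| "sem (Times x e) s = put x (s x 0 * expr_val e s) (put mult_a 0 (put mult_b 0 s))"

primrec writes :: "com \<Rightarrow> string set" where
  "writes Nop = {}"
| "writes (Assign a e f) = {a}"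
| "writes (p ;; q) = writes p \<union> writes q"
| "writes (Branch e p q) = writes p \<union> writes q"
| "writes (For x e p) = insert x (writes p)"
| "writes (Times x e) = {x, mult_a, mult_b}"

abbreviation count :: expr where
  "count \<equiv> Cell ''input'' (Num 1)"

text \<open>Two restrictions yield polynomial time. Loop bounds are one or two times the number of
  edges, read from an input that is never written. Multipliers are input cells, so their binary
  length, and with it the number of doubling rounds, is bounded by the input size.\<close>

primrec wf_com :: "com \<Rightarrow> bool" where
  "wf_com Nop \<longleftrightarrow> True"
| "wf_com (Assign a e f) \<longleftrightarrow> a \<noteq> ''input''"
| "wf_com (p ;; q) \<longleftrightarrow> wf_com p \<and> wf_com q"
| "wf_com (Branch e p q) \<longleftrightarrow> wf_com p \<and> wf_com q"
| "wf_com (For x e p) \<longleftrightarrow> e \<in> {count, Add count count} \<and> x \<noteq> ''input'' \<and> x \<notin> writes p \<and> wf_com p"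
| "wf_com (Times x e) \<longleftrightarrow> (\<exists>f. e = Cell ''input'' f) \<and> x \<notin> {''input'', mult_a, mult_b}"

text \<open>The variable is a common bound on the number of edges and on the binary lengths of the
  input cells: a loop makes at most twice that many rounds, a multiplication one round per bit. A
  branch is charged for both arms.\<close>

primrec time_poly :: "com \<Rightarrow> nat poly" where
  "time_poly Nop = [:1:]"
| "time_poly (Assign a e f) = [:1 + expr_time e + expr_time f:]"
| "time_poly (p ;; q) = time_poly p + time_poly q"
| "time_poly (Branch e p q) = [:1 + expr_time e:] + time_poly p + time_poly q"
| "time_poly (For x e p) = [:3:] + [:0, 2:] * ([:10 + expr_time e:] + time_poly p) + [:4 + expr_time e:]"
| "time_poly (Times x e) = [:15 + expr_time e:] + [:0, 40:]"

section \<open>Correctness and running time of compiled programs\<close>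

lemma sem_frame: "a \<notin> writes p \<Longrightarrow> sem p s a = s a"
proof (induction p arbitrary: s)
  case (For x e p)
  have "rec_nat (put x 0 s) (\<lambda>k s'. put x (Suc k) (sem p s')) n a = s a" for n
    using For by (induction n) (auto simp: put_def)
  then show ?case by simp
qed (auto simp: put_def)

lemma wf_com_input: "wf_com p \<Longrightarrow> ''input'' \<notin> writes p"
  by (induction p) auto

lemma exec_Store':
  "n = 1 + expr_time e + expr_time f \<Longrightarrow> s' = s(a := (s a)(expr_val e s := expr_val f s)) \<Longrightarrow>
    exec (Store a e f) s n s'"
  by (simp only: exec_Store)

text \<open>One round per bit of \<open>mult_b\<close>, with \<open>x + mult_a * mult_b\<close>
  unchanged. A round takes at most 33 units and the final failing test 3.\<close>

lemma exec_mult_loop: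
  assumes "x \<notin> {mult_a, mult_b}" "floorlog 2 (s mult_b 0) \<le> n"
  shows "\<exists>t \<le> 40 * n + 3. exec (While (Var mult_b) (mult_body x)) s t
    (put x (s x 0 + s mult_a 0 * s mult_b 0)
      (put mult_a (s mult_a 0 * 2 ^ floorlog 2 (s mult_b 0)) (put mult_b 0 s)))"
  using assms(2)
proof (induction n arbitrary: s)
  case 0
  then have "s mult_b 0 = 0" by (simp add: floorlog_eq_zero_iff)
  then show ?case using exec_While_false[of "Var mult_b" s "mult_body x"] assms(1)
    by (auto simp: put_def floorlog_def fun_upd_idem numeral_3_eq_3 intro!: exI[of _ 3])
next
  case (Suc n)
  show ?case
  proof (cases "s mult_b 0 = 0")
    case True
    then show ?thesis using exec_While_false[of "Var mult_b" s "mult_body x"] assms(1)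
      by (auto simp: put_def floorlog_def fun_upd_idem numeral_3_eq_3 intro!: exI[of _ 3])
  next
    case False
    define y where "y = s mult_b 0"
    define s1 where "s1 = (if odd y then put x (s x 0 + s mult_a 0) s else s)"
    define s2 where "s2 = put mult_b (y div 2) (put mult_a (2 * s mult_a 0) s1)"
    let ?C = "Cond (Sub (Var mult_b) (Add (Half (Var mult_b)) (Half (Var mult_b))))
            (Store x (Num 0) (Add (Var x) (Var mult_a))) Skip"
    have odd: "y - (y div 2 + y div 2) = y mod 2" by presburger
    let ?e = "Sub (Var mult_b) (Add (Half (Var mult_b)) (Half (Var mult_b)))"
    have val: "expr_val ?e s = y mod 2" by (simp add: odd y_def[symmetric])
    have 1: "\<exists>t \<le> 18. exec ?C s t s1"
    proof (cases "odd y")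
      case True
      have "exec ?C s (1 + expr_time ?e + (1 + expr_time (Num 0) + expr_time (Add (Var x) (Var mult_a))))
          (s(x := (s x)(expr_val (Num 0) s := expr_val (Add (Var x) (Var mult_a)) s)))"
        by (rule exec_Cond_true[OF _ exec_Store]) (use True val in presburger)
      then show ?thesis
        using True by (intro exI[of _ "1 + expr_time ?e + (1 + expr_time (Num 0) + expr_time (Add (Var x) (Var mult_a)))"])
          (simp add: s1_def put_def)
    next
      case False
      have "exec ?C s (1 + expr_time ?e + 1) s"
        by (rule exec_Cond_false[OF _ exec_Skip]) (use False val in presburger)
      then show ?thesis
        using False by (intro exI[of _ "1 + expr_time ?e + 1"]) (simp add: s1_def)
    qed
    then obtain t1 where t1: "t1 \<le> 18" "exec ?C s t1 s1" by blast
    have s1: "s1 mult_a = s mult_a" "s1 mult_b = s mult_b"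
      using assms(1) by (auto simp: s1_def put_def)
    have "exec (Store mult_a (Num 0) (Add (Var mult_a) (Var mult_a))) s1 7 (put mult_a (2 * s mult_a 0) s1)"
      by (rule exec_Store') (use s1 in \<open>simp_all add: put_def mult_2\<close>)
    moreover have "exec (Store mult_b (Num 0) (Half (Var mult_b))) (put mult_a (2 * s mult_a 0) s1) 5 s2"
      by (rule exec_Store') (use s1 in \<open>simp_all add: put_def s2_def y_def\<close>)
    ultimately have body: "exec (mult_body x) s (t1 + 12) s2"
      unfolding mult_body_def using t1(2) exec_Seq[of _ _ 7 _ _ 5] exec_Seq by fastforce
    have fl: "floorlog 2 y = Suc (floorlog 2 (y div 2))"
      using False compute_floorlog[of 2 y] by (simp add: y_def)
    have s2: "s2 mult_b 0 = y div 2" "s2 mult_a 0 = 2 * s mult_a 0"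
      "s2 x 0 = s x 0 + s mult_a 0 * (y mod 2)"
      using assms(1) by (auto simp: s2_def s1_def put_def odd_iff_mod_2_eq_one even_iff_mod_2_eq_zero)
    obtain t where t: "t \<le> 40 * n + 3" "exec (While (Var mult_b) (mult_body x)) s2 t
      (put x (s2 x 0 + s2 mult_a 0 * s2 mult_b 0)
        (put mult_a (s2 mult_a 0 * 2 ^ floorlog 2 (s2 mult_b 0)) (put mult_b 0 s2)))"
      using Suc.IH[of s2] Suc.prems fl s2 by (auto simp: y_def)
    have "s2 x 0 + s2 mult_a 0 * s2 mult_b 0 = s x 0 + s mult_a 0 * (y mod 2 + 2 * (y div 2))"
      unfolding s2 distrib_left by simp
    also have "\<dots> = s x 0 + s mult_a 0 * y" by (simp only: mod_mult_div_eq)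
    finally have "put x (s2 x 0 + s2 mult_a 0 * s2 mult_b 0)
        (put mult_a (s2 mult_a 0 * 2 ^ floorlog 2 (s2 mult_b 0)) (put mult_b 0 s2))
      = put x (s x 0 + s mult_a 0 * y) (put mult_a (s mult_a 0 * 2 ^ floorlog 2 y) (put mult_b 0 s))"
      using assms(1) by (simp add: s2 fl) (auto simp: s2_def s1_def put_def fun_eq_iff)
    then have "exec (While (Var mult_b) (mult_body x)) s (1 + 2 + (t1 + 12) + t)
      (put x (s x 0 + s mult_a 0 * y) (put mult_a (s mult_a 0 * 2 ^ floorlog 2 y) (put mult_b 0 s)))"
      using exec_While_true[of "Var mult_b" s, OF _ body t(2)] False by simp
    moreover have "1 + 2 + (t1 + 12) + t \<le> 40 * Suc n + 3" using t t1 by simp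
    ultimately show ?thesis unfolding y_def by blast
  qed
qed

lemma exec_compile:
  assumes "wf_com p" "s ''input'' 1 \<le> N" "\<forall>i. floorlog 2 (s ''input'' i) \<le> N"
  shows "\<exists>t \<le> poly (time_poly p) N. exec (compile p) s t (sem p s)"
  using assms
proof (induction p arbitrary: s)
  case Nop
  then show ?case using exec_Skip by fastforce
next
  case (Assign a e f)
  show ?case using exec_Store[of a e f s]
    by (intro exI[of _ "1 + expr_time e + expr_time f"]) (simp add: fun_upd_def)
next
  case (Then p q)
  have eq: "sem p s ''input'' = s ''input''"
    using Then.prems(1) by (intro sem_frame wf_com_input) simp
  obtain t u where "t \<le> poly (time_poly p) N" "exec (compile p) s t (sem p s)"
    "u \<le> poly (time_poly q) N" "exec (compile q) (sem p s) u (sem q (sem p s))"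
    using Then.IH(1)[of s] Then.IH(2)[of "sem p s"] Then.prems unfolding eq by auto
  then show ?case by (intro exI[of _ "t + u"]) (auto intro: exec_Seq add_mono)
next
  case (Branch e p q)
  show ?case
  proof (cases "expr_val e s = 0")
    case True
    obtain t where "t \<le> poly (time_poly q) N" "exec (compile q) s t (sem q s)"
      using Branch.IH(2)[of s] Branch.prems by auto
    then show ?thesis using True exec_Cond_false[of e s]
      by (intro exI[of _ "1 + expr_time e + t"]) auto
  next
    case False
    obtain t where "t \<le> poly (time_poly p) N" "exec (compile p) s t (sem p s)"
      using Branch.IH(1)[of s] Branch.prems by auto
    then show ?thesis using False exec_Cond_true[of e s]
      by (intro exI[of _ "1 + expr_time e + t"]) auto
  qed
next
  case (For x e p)
  let ?f = "rec_nat (put x 0 s) (\<lambda>k s'. put x (Suc k) (sem p s'))"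
  let ?w = "While (Sub e (Var x)) (Seq (compile p) (Store x (Num 0) (Add (Var x) (Num 1))))"
  \<comment> \<open>The cost of a round: evaluating \<open>e\<close>, 4 further units for the loop
    test and 6 for the counter, besides the body.\<close>
  define B where "B = 10 + expr_time e + poly (time_poly p) N"
  have wf: "e \<in> {count, Add count count}" "x \<noteq> ''input''" "x \<notin> writes p" "wf_com p"
    using For.prems(1) by auto
  have inp: "?f k ''input'' = s ''input''" for k
    using wf by (induction k) (auto simp: put_def sem_frame wf_com_input)
  have x: "?f k x 0 = k" for k by (cases k) (auto simp: put_def)
  have e: "expr_val e (?f k) = expr_val e s" for k using wf(1) inp[of k] by auto
  have "\<exists>t \<le> j * B + (4 + expr_time e). exec ?w (?f k) t (?f (expr_val e s))"
    if "k + j = expr_val e s" for j k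
    using that
  proof (induction j arbitrary: k)
    case 0
    then show ?case using exec_While_false[of "Sub e (Var x)" "?f k"] x[of k] e[of k]
      by (intro exI[of _ "1 + expr_time (Sub e (Var x))"]) auto
  next
    case (Suc j)
    obtain t where t: "t \<le> poly (time_poly p) N" "exec (compile p) (?f k) t (sem p (?f k))"
      using For.IH[OF wf(4), of "?f k"] For.prems(2,3) unfolding inp by auto
    have "sem p (?f k) x 0 = k" using sem_frame[OF wf(3)] x by simp
    then have "exec (Store x (Num 0) (Add (Var x) (Num 1))) (sem p (?f k)) 6 (?f (Suc k))"
      by (intro exec_Store') (simp_all add: put_def)
    with t(2) have body: "exec (Seq (compile p) (Store x (Num 0) (Add (Var x) (Num 1)))) (?f k) (t + 6) (?f (Suc k))"
      by (rule exec_Seq)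
    obtain u where u: "u \<le> j * B + (4 + expr_time e)" "exec ?w (?f (Suc k)) u (?f (expr_val e s))"
      using Suc.IH[of "Suc k"] Suc.prems by auto
    have "exec ?w (?f k) (1 + expr_time (Sub e (Var x)) + (t + 6) + u) (?f (expr_val e s))"
      by (rule exec_While_true[OF _ body u(2)]) (use Suc.prems x[of k] e[of k] in simp)
    moreover have "1 + expr_time (Sub e (Var x)) + (t + 6) + u \<le> Suc j * B + (4 + expr_time e)"
      using t(1) u(1) by (simp add: B_def)
    ultimately show ?case by blast
  qed
  from this[of 0 "expr_val e s"] obtain t where t: "t \<le> expr_val e s * B + (4 + expr_time e)"
    "exec ?w (put x 0 s) t (?f (expr_val e s))" by auto
  have "exec (Store x (Num 0) (Num 0)) s 3 (put x 0 s)"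
    by (rule exec_Store') (simp_all add: put_def)
  then have "exec (compile (For x e p)) s (3 + t) (sem (For x e p) s)"
    using t(2) by (simp add: exec_Seq)
  moreover have "expr_val e s \<le> 2 * N" using wf(1) For.prems(2) by auto
  then have "expr_val e s * B \<le> (2 * N) * B" by (rule mult_right_mono) simp
  then have "3 + t \<le> poly (time_poly (For x e p)) N" using t(1) by (simp add: B_def algebra_simps)
  ultimately show ?case by blast
next
  case (Times x e)
  from Times.prems obtain f where e: "e = Cell ''input'' f"
    and x: "x \<notin> {mult_a, mult_b}" "x \<noteq> ''input''" by auto
  define y where "y = expr_val e s"
  let ?s1 = "put mult_b y s"
  let ?s2 = "put mult_a (s x 0) ?s1"
  let ?s3 = "put x 0 ?s2"
  have y: "floorlog 2 y \<le> N" using Times.prems(3) by (simp add: y_def e)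
  have s3: "?s3 mult_a 0 = s x 0" "?s3 mult_b 0 = y" "?s3 x 0 = 0"
    using x by (auto simp: put_def)
  have 1: "exec (Store mult_b (Num 0) e) s (2 + expr_time e) ?s1"
    by (rule exec_Store') (simp_all add: put_def y_def)
  have 2: "exec (Store mult_a (Num 0) (Var x)) ?s1 4 ?s2"
    by (rule exec_Store') (use x in \<open>simp_all add: put_def\<close>)
  have 3: "exec (Store x (Num 0) (Num 0)) ?s2 3 ?s3"
    by (rule exec_Store') (simp_all add: put_def)
  obtain t where t: "t \<le> 40 * N + 3" "exec (While (Var mult_b) (mult_body x)) ?s3 t
    (put x (s x 0 * y) (put mult_a (s x 0 * 2 ^ floorlog 2 y) (put mult_b 0 ?s3)))" (is "exec _ _ _ ?s4")
    using exec_mult_loop[OF x(1), of ?s3 N] y unfolding s3 by auto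
  have 5: "exec (Store mult_a (Num 0) (Num 0)) ?s4 3 (put mult_a 0 ?s4)"
    by (rule exec_Store') (simp_all add: put_def)
  have "put mult_a 0 ?s4 = sem (Times x e) s"
    using x by (auto simp: put_def fun_eq_iff y_def)
  with exec_Seq[OF 1 exec_Seq[OF 2 exec_Seq[OF 3 exec_Seq[OF t(2) 5]]]]
  have "exec (compile (Times x e)) s (2 + expr_time e + (4 + (3 + (t + 3)))) (sem (Times x e) s)"
    by simp
  moreover have "2 + expr_time e + (4 + (3 + (t + 3))) \<le> poly (time_poly (Times x e)) N"
    using t(1) by simp
  ultimately show ?case by blast
qed

lemma sem_For_induct:
  assumes "I 0 (put x 0 s)"
    and "\<And>k s'. k < expr_val e s \<Longrightarrow> I k s' \<Longrightarrow> I (Suc k) (put x (Suc k) (sem p s'))"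
  shows "I (expr_val e s) (sem (For x e p) s)"
proof -
  have "I k (rec_nat (put x 0 s) (\<lambda>k s'. put x (Suc k) (sem p s')) k)" if "k \<le> expr_val e s" for k
    using that assms by (induction k) auto
  then show ?thesis by simp
qed

text \<open>Truth is being nonzero; a truncated difference is nonzero exactly for a strict
  inequality.\<close>

definition ELess :: "expr \<Rightarrow> expr \<Rightarrow> expr" where "ELess e f = Sub f e"
definition ENot :: "expr \<Rightarrow> expr" where "ENot e = Sub (Num 1) e"
definition EAnd :: "expr \<Rightarrow> expr \<Rightarrow> expr" where "EAnd e f = ENot (Add (ENot e) (ENot f))"
definition EOr :: "expr \<Rightarrow> expr \<Rightarrow> expr" where "EOr e f = Add e f"
definition EEq :: "expr \<Rightarrow> expr \<Rightarrow> expr" where "EEq e f = ENot (Add (Sub e f) (Sub f e))"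

lemma expr_val_tests [simp]:
  "expr_val (ELess e f) s = 0 \<longleftrightarrow> \<not> expr_val e s < expr_val f s"
  "expr_val (ENot e) s = 0 \<longleftrightarrow> expr_val e s \<noteq> 0"
  "expr_val (EAnd e f) s = 0 \<longleftrightarrow> expr_val e s = 0 \<or> expr_val f s = 0"
  "expr_val (EOr e f) s = 0 \<longleftrightarrow> expr_val e s = 0 \<and> expr_val f s = 0"
  "expr_val (EEq e f) s = 0 \<longleftrightarrow> expr_val e s \<noteq> expr_val f s"
  by (auto simp: ELess_def ENot_def EAnd_def EOr_def EEq_def)

section \<open>The program and its semantics\<close>

type_synonym listing = "(nat \<times> nat \<times> nat \<times> nat) list"

text \<open>Darts \<open>2 * i\<close> and \<open>2 * i + 1\<close> are the two orientations of the \<open>i\<close>-th listed edge.\<close>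

definition dart_src :: "listing \<Rightarrow> nat \<Rightarrow> nat" where
  "dart_src es d = (if even d then fst (es ! (d div 2)) else fst (snd (es ! (d div 2))))"

definition dart_dst :: "listing \<Rightarrow> nat \<Rightarrow> nat" where
  "dart_dst es d = (if even d then fst (snd (es ! (d div 2))) else fst (es ! (d div 2)))"

definition dart_mate :: "nat \<Rightarrow> nat" where
  "dart_mate d = (if even d then d + 1 else d - 1)"

definition denom :: "listing \<Rightarrow> nat \<Rightarrow> nat" where
  "denom es i = snd (snd (snd (es ! i)))"

text \<open>Costs are made integral by multiplying them with the product of all denominators.\<close>

definition int_cost :: "listing \<Rightarrow> nat \<Rightarrow> nat" where
  "int_cost es i = fst (snd (snd (es ! i))) * (\<Prod>j\<in>{..<length es} - {i}. denom es j)"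

definition dart_cost :: "listing \<Rightarrow> nat \<Rightarrow> nat" where
  "dart_cost es d = int_cost es (d div 2)"

text \<open>Quadruple \<open>i\<close> starts behind the two counters and the \<open>n\<close>
  bounds, at \<open>2 + n + 4 * i\<close>; the multiple of 4 is spelled out as a sum.\<close>

definition field_of :: "expr \<Rightarrow> nat \<Rightarrow> expr" where
  "field_of e j = Cell ''input''
     (Add (Add (Num (2 + j)) (Cell ''input'' (Num 0))) (Add (Add e e) (Add e e)))"

definition bound_of :: "expr \<Rightarrow> expr" where
  "bound_of e = Cell ''input'' (Add (Num 2) e)"

abbreviation "Src e \<equiv> Cell ''t'' e"
abbreviation "Dst e \<equiv> Cell ''h'' e"
abbreviation "Cost e \<equiv> Cell ''c'' e"
abbreviation "src_rank e \<equiv> Cell ''a'' e"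
abbreviation "dst_rank e \<equiv> Cell ''b'' e"
abbreviation "Base e \<equiv> Cell ''z'' e"
abbreviation "Covered e \<equiv> Cell ''K'' e"
abbreviation "darts_count \<equiv> Add count count"
abbreviation "set_var x e \<equiv> Assign x (Num 0) e"
abbreviation "add_var x e \<equiv> Assign x (Num 0) (Add (Var x) e)"

text \<open>The growing product sits in \<open>x\<close>, so that the multiplier is always an input
  cell, as \<open>wf_com\<close> demands.\<close>

definition scale_cost :: com where
  "scale_cost = For ''j'' count
     (Branch (EEq (Var ''i'') (Var ''j'')) Nop (Times ''x'' (field_of (Var ''j'') 3)))"

definition load_edge :: com where
  "load_edge =
     (set_var ''e'' (Add (Var ''i'') (Var ''i'')) ;;
      Assign ''t'' (Var ''e'') (field_of (Var ''i'') 0) ;;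
      Assign ''h'' (Var ''e'') (field_of (Var ''i'') 1) ;;
      Assign ''t'' (Add (Var ''e'') (Num 1)) (field_of (Var ''i'') 1) ;;
      Assign ''h'' (Add (Var ''e'') (Num 1)) (field_of (Var ''i'') 0) ;;
      set_var ''x'' (field_of (Var ''i'') 2) ;;
      scale_cost ;;
      Assign ''c'' (Var ''e'') (Var ''x'') ;;
      Assign ''c'' (Add (Var ''e'') (Num 1)) (Var ''x''))"

definition load_darts :: com where
  "load_darts = For ''i'' count load_edge"

text \<open>\<open>Half\<close> turns a dart into its edge number, the tie-breaker of
  \<open>cheaper\<close>.\<close>

definition Cheaper :: "expr \<Rightarrow> expr \<Rightarrow> expr" where
  "Cheaper e f = EOr (ELess (Cost e) (Cost f)) (EAnd (EEq (Cost e) (Cost f)) (ELess (Half e) (Half f)))"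

definition count_cheaper :: com where
  "count_cheaper = For ''f'' darts_count
     (Branch (EAnd (EEq (Src (Var ''f'')) (Src (Var ''d''))) (Cheaper (Var ''f'') (Var ''d'')))
        (add_var ''k'' (Num 1)) Nop ;;
      Branch (EAnd (EEq (Src (Var ''f'')) (Dst (Var ''d''))) (Cheaper (Var ''f'') (Var ''d'')))
        (add_var ''l'' (Num 1)) Nop)"

definition rank_darts :: com where
  "rank_darts = For ''d'' darts_count
     (set_var ''k'' (Num 0) ;; set_var ''l'' (Num 0) ;; count_cheaper ;;
      Assign ''a'' (Var ''d'') (Var ''k'') ;; Assign ''b'' (Var ''d'') (Var ''l''))"

text \<open>Memory starts at 0, so the sum defining \<open>base\<close> is accumulated in place.
  Early edges go straight to the output.\<close>

definition find_base :: com where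
  "find_base = For ''d'' darts_count
     (Branch (EEq (Add (src_rank (Var ''d'')) (Num 1)) (bound_of (Src (Var ''d''))))
        (Assign ''z'' (Src (Var ''d'')) (Add (Base (Src (Var ''d''))) (Cost (Var ''d'')))) Nop ;;
      Branch (ELess (Add (src_rank (Var ''d'')) (Num 1)) (bound_of (Src (Var ''d''))))
        (Assign ''output'' (Half (Var ''d'')) (Num 1)) Nop)"

text \<open>The test \<open>r v \<le> k + 1\<close>, turned into a strict inequality.\<close>

definition Late :: "expr \<Rightarrow> expr \<Rightarrow> expr" where
  "Late v k = ELess (bound_of v) (Add k (Num 2))"

definition Loss :: "expr \<Rightarrow> expr \<Rightarrow> expr" where
  "Loss v d = Add (Sub (Cost d) (Base v)) (Sub (Cost d) (Base v))"

text \<open>Whether to buy depends on the totals, and all gains must refer to the coverage before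
  the purchase. Hence the star is first recorded in a scratch array, which every run rewrites
  completely, so no marks of earlier stars survive.\<close>

definition collect_star :: com where
  "collect_star = For ''f'' darts_count
     (Branch (EAnd (ENot (Covered (Dst (Var ''f'')))) (Late (Dst (Var ''f'')) (dst_rank (Var ''f''))))
        (set_var ''u'' (Base (Dst (Var ''f'')))) (set_var ''u'' (Num 0)) ;;
      set_var ''w'' (Loss (Dst (Var ''f'')) (Var ''f'')) ;;
      Branch (EOr (EEq (Var ''f'') (Var ''d''))
          (EAnd (EEq (Src (Var ''f'')) (Src (Var ''d'')))
            (EAnd (ENot (ELess (Cost (Var ''d'')) (Cost (Var ''f'')))) (ELess (Var ''w'') (Var ''u'')))))
        (Assign ''s'' (Var ''f'') (Num 1) ;; add_var ''g'' (Var ''u'') ;; add_var ''l'' (Var ''w''))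
        (Assign ''s'' (Var ''f'') (Num 0)))"

definition apply_star :: com where
  "apply_star = For ''f'' darts_count
     (Branch (Cell ''s'' (Var ''f''))
        (Assign ''output'' (Half (Var ''f'')) (Num 1) ;;
         Branch (Late (Dst (Var ''f'')) (dst_rank (Var ''f'')))
           (Assign ''K'' (Dst (Var ''f'')) (Num 1)) Nop) Nop)"

definition greedy_pass :: com where
  "greedy_pass = For ''d'' darts_count
     (Branch (EAnd (ENot (Covered (Src (Var ''d'')))) (Late (Src (Var ''d'')) (src_rank (Var ''d''))))
        (set_var ''g'' (Base (Src (Var ''d'')))) (set_var ''g'' (Num 0)) ;;
      set_var ''l'' (Loss (Src (Var ''d'')) (Var ''d'')) ;;
      collect_star ;;
      Branch (ELess (Var ''l'') (Var ''g''))
        (apply_star ;;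
         Branch (Late (Src (Var ''d'')) (src_rank (Var ''d''))) (Assign ''K'' (Src (Var ''d'')) (Num 1)) Nop)
        Nop)"

definition add_fallback :: com where
  "add_fallback = For ''d'' darts_count
     (Branch (EAnd (EEq (Add (src_rank (Var ''d'')) (Num 1)) (bound_of (Src (Var ''d''))))
          (ENot (Covered (Src (Var ''d'')))))
        (Assign ''output'' (Half (Var ''d'')) (Num 1)) Nop)"

definition mpemc_com :: com where
  "mpemc_com = load_darts ;; rank_darts ;; find_base ;; greedy_pass ;; add_fallback"

lemmas com_defs = mpemc_com_def load_darts_def load_edge_def scale_cost_def rank_darts_def count_cheaper_def
  find_base_def greedy_pass_def collect_star_def apply_star_def add_fallback_def

lemma wf_mpemc_com: "wf_com mpemc_com"
  by (simp add: com_defs field_of_def)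

section \<open>The input array and the dart graph of an encoded instance\<close>

lemma nth_concat_4:
  "i < length xs \<Longrightarrow> (\<And>x. length (f x) = 4) \<Longrightarrow> j < 4 \<Longrightarrow>
    concat (map f xs) ! (4 * i + j) = f (xs ! i) ! j"
proof (induction xs arbitrary: i)
  case (Cons x xs)
  then show ?case by (cases i) (auto simp: nth_append)
qed simp

lemma length_concat_4: "(\<And>x. length (f x) = 4) \<Longrightarrow> length (concat (map f xs)) = 4 * length xs"
  by (induction xs) auto

lemma card_filter_Suc:
  "card {x \<in> {..<Suc k}. Q x} = card {x \<in> {..<k}. Q x} + (if Q k then 1 else 0)"
proof -
  have "{x \<in> {..<Suc k}. Q x} = (if Q k then insert k {x \<in> {..<k}. Q x} else {x \<in> {..<k}. Q x})"
    by (auto simp: less_Suc_eq)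
  then show ?thesis by simp
qed

lemma sum_filter_Suc:
  "(\<Sum>x | x < Suc k \<and> Q x. f x) = (\<Sum>x | x < k \<and> Q x. f x) + (if Q k then f k else (0::nat))"
proof -
  have "{x. x < Suc k \<and> Q x} = (if Q k then insert k {x. x < k \<and> Q x} else {x. x < k \<and> Q x})"
    by (auto simp: less_Suc_eq)
  then show ?thesis by simp
qed

locale encoded_instance =
  fixes G :: "nat mpemc" and es :: listing
  assumes inst: "mpemc_instance G" and verts_G: "verts G = {..<card (verts G)}"
    and listing: "edge_listing G es"
begin

abbreviation "n \<equiv> card (verts G)"
abbreviation "m \<equiv> length es"

lemma verts_iff: "v \<in> verts G \<longleftrightarrow> v < n"
  by (subst verts_G) simp

lemma edge_of_dart: "edge_of (es ! (d div 2)) = {dart_src es d, dart_dst es d}"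
  by (auto simp: edge_of_def dart_src_def dart_dst_def split: prod.split)

lemma edge_of_inj: "i < m \<Longrightarrow> j < m \<Longrightarrow> edge_of (es ! i) = edge_of (es ! j) \<Longrightarrow> i = j"
  using listing nth_eq_iff_index_eq[of "map edge_of es" i j] by (simp add: edge_listing_def)

lemma edge_of_edges: "i < m \<Longrightarrow> edge_of (es ! i) \<in> edges G"
  using listing by (auto simp: edge_listing_def)

lemma edge_of_verts: "i < m \<Longrightarrow> edge_of (es ! i) \<subseteq> verts G"
  using inst edge_of_edges by (auto simp: mpemc_instance_def)

lemma dart_src_neq_dst: "d < 2 * m \<Longrightarrow> dart_src es d \<noteq> dart_dst es d"
  using inst edge_of_edges[of "d div 2"] unfolding edge_of_dart mpemc_instance_def by force

sublocale dart_graph "verts G" "{..<2 * m}" "dart_src es" "dart_dst es" dart_mate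
  "\<lambda>d. d div 2" "dart_cost es" "bound G"
proof
  show "finite (verts G)" using inst by (simp add: mpemc_instance_def)
  fix d assume d: "d \<in> {..<2 * m}"
  then have i: "d div 2 < m" by auto
  show "dart_src es d \<in> verts G" using edge_of_verts[OF i] by (simp add: edge_of_dart)
  show "dart_mate d \<in> {..<2 * m}" using d by (cases "even d") (simp_all add: dart_mate_def, presburger)
  have mate: "dart_mate d div 2 = d div 2" "even (dart_mate d) \<longleftrightarrow> odd d"
    by (cases "even d"; simp add: dart_mate_def; presburger)+
  then show "dart_src es (dart_mate d) = dart_dst es d" "dart_dst es (dart_mate d) = dart_src es d"
    "dart_cost es (dart_mate d) = dart_cost es d" "dart_mate d div 2 = d div 2"
    by (auto simp: dart_src_def dart_dst_def dart_cost_def)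
  show "dart_src es d \<noteq> dart_dst es d" using dart_src_neq_dst d by simp
  fix d' assume d': "d' \<in> {..<2 * m}"
  show "d' = d \<or> d' = dart_mate d" if "d div 2 = d' div 2"
    using that by (cases "even d"; simp add: dart_mate_def; presburger)
  show "d = d'" if eq: "dart_src es d = dart_src es d'" "dart_dst es d = dart_dst es d'"
  proof -
    \<comment> \<open>Equal ends mean the same listed edge, as the listing has no repetitions; equal
      parity then follows because the two ends differ.\<close>
    have "d div 2 = d' div 2"
      by (rule edge_of_inj) (use d d' eq in \<open>auto simp: edge_of_dart\<close>)
    moreover have "even d \<longleftrightarrow> even d'"
      using eq calculation dart_src_neq_dst[of d] d
      by (cases "even d"; cases "even d'"; simp add: dart_src_def dart_dst_def)
    ultimately show ?thesis by presburger
  qed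
qed simp

definition inp :: "nat \<Rightarrow> nat" where
  "inp = input_memory (encode G es) ''input''"

lemma length_encode: "length (encode G es) = 2 + n + 4 * m"
  by (simp add: encode_def length_concat_4 split_def)

lemma inp_0 [simp]: "inp 0 = n" and inp_1 [simp]: "inp (Suc 0) = m"
  by (simp_all add: inp_def input_memory_def encode_def)

lemma inp_bound: "v < n \<Longrightarrow> inp (Suc (Suc v)) = bound G v"
  by (simp add: inp_def input_memory_def encode_def nth_append)

lemma inp_field:
  assumes "i < m" "j < 4"
  shows "inp (2 + j + n + 4 * i) = (case es ! i of (u, v, a, b) \<Rightarrow> [u, v, a, b] ! j)"
proof -
  have "2 + j + n + 4 * i < length (encode G es)" using assms by (simp add: length_encode)
  then have "inp (2 + j + n + 4 * i) = (encode G es) ! (2 + j + n + 4 * i)"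
    by (simp add: inp_def input_memory_def)
  also have "\<dots> = concat (map (\<lambda>(u, v, a, b). [u, v, a, b]) es) ! (4 * i + j)"
    by (simp add: encode_def nth_append add.commute)
  also have "\<dots> = (case es ! i of (u, v, a, b) \<Rightarrow> [u, v, a, b] ! j)"
    using assms by (subst nth_concat_4) (auto split: prod.split)
  finally show ?thesis .
qed

lemma src_less: "d < 2 * m \<Longrightarrow> dart_src es d < n" and dst_less: "d < 2 * m \<Longrightarrow> dart_dst es d < n"
  using src_V[of d] dst_V[of d] by (auto simp: verts_iff)

lemma val_field:
  assumes "s ''input'' = inp" "expr_val e s < m"
  shows "expr_val (field_of e 0) s = fst (es ! expr_val e s)"
    "expr_val (field_of e (Suc 0)) s = fst (snd (es ! expr_val e s))"
    "expr_val (field_of e 2) s = fst (snd (snd (es ! expr_val e s)))"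
    "expr_val (field_of e 3) s = denom es (expr_val e s)"
proof -
  have "expr_val (field_of e j) s = (case es ! expr_val e s of (u, v, a, b) \<Rightarrow> [u, v, a, b] ! j)"
    if "j < 4" for j
  proof -
    have four: "v + v + (v + v) = 4 * v" for v :: nat by simp
    have "expr_val (field_of e j) s = inp (2 + j + n + 4 * expr_val e s)"
      unfolding field_of_def expr_val.simps four assms(1) by simp
    then show ?thesis using inp_field[OF assms(2) that] by simp
  qed
  from this[of 0] this[of "Suc 0"] this[of 2] this[of 3]
  show "expr_val (field_of e 0) s = fst (es ! expr_val e s)"
    "expr_val (field_of e (Suc 0)) s = fst (snd (es ! expr_val e s))"
    "expr_val (field_of e 2) s = fst (snd (snd (es ! expr_val e s)))"
    "expr_val (field_of e 3) s = denom es (expr_val e s)"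
    by (simp_all add: denom_def split_def)
qed

section \<open>Loop invariants for the phases of the program\<close>

definition loaded :: "memory \<Rightarrow> bool" where
  "loaded s \<longleftrightarrow> s ''input'' = inp \<and>
     (\<forall>d<2 * m. s ''t'' d = dart_src es d \<and> s ''h'' d = dart_dst es d \<and> s ''c'' d = dart_cost es d)"

definition ranked :: "memory \<Rightarrow> bool" where
  "ranked s \<longleftrightarrow> loaded s \<and>
     (\<forall>d<2 * m. s ''a'' d = rk (dart_src es d) d \<and> s ''b'' d = rk (dart_dst es d) d)"

text \<open>All cells are included, not only those of vertices: elsewhere \<open>base\<close> is an
  empty sum, and the cells keep their initial 0.\<close>

definition based :: "memory \<Rightarrow> bool" where
  "based s \<longleftrightarrow> ranked s \<and> (\<forall>v. s ''z'' v = base v)"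

definition selected :: "memory \<Rightarrow> nat set" where
  "selected s = {i. s ''output'' i \<noteq> 0}"

definition covered :: "memory \<Rightarrow> nat set" where
  "covered s = {v. s ''K'' v \<noteq> 0}"

lemma scale_cost:
  assumes "s ''input'' = inp" "s ''i'' 0 = i"
  shows "sem scale_cost s ''x'' 0 = s ''x'' 0 * (\<Prod>j\<in>{..<m} - {i}. denom es j)"
proof -
  let ?I = "\<lambda>k s'. s' ''input'' = inp \<and> s' ''i'' 0 = i \<and> s' ''j'' 0 = k \<and>
    s' ''x'' 0 = s ''x'' 0 * (\<Prod>j\<in>{..<k} - {i}. denom es j)"
  have "?I (expr_val count s) (sem scale_cost s)"
    unfolding scale_cost_def
  proof (rule sem_For_induct[where I = ?I], goal_cases)
    case 1
    show ?case using assms by (simp add: put_def)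
  next
    case (2 k s')
    then have k: "k < m" using assms by simp
    have val: "expr_val (field_of (Var ''j'') 3) s' = denom es k"
      using 2 k val_field(4)[of s' "Var ''j''"] by simp
    have "{..<Suc k} - {i} = (if i = k then {..<k} - {i} else insert k ({..<k} - {i}))"
      by (auto simp: less_Suc_eq)
    then have prod: "(\<Prod>j\<in>{..<Suc k} - {i}. denom es j)
        = (if i = k then 1 else denom es k) * (\<Prod>j\<in>{..<k} - {i}. denom es j)"
      by simp
    show ?case unfolding prod using 2(2) by (simp add: val put_def)
  qed
  then show ?thesis using assms by simp
qed

lemma frame_scale_cost:
  "a \<notin> {''j'', ''x'', mult_a, mult_b} \<Longrightarrow> sem scale_cost s a = s a"
  by (rule sem_frame) (simp add: scale_cost_def)

lemma load_edge:
  assumes "s ''input'' = inp" "s ''i'' 0 = k" "k < m"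
  shows "sem load_edge s ''t'' = (s ''t'')(2 * k := dart_src es (2 * k), Suc (2 * k) := dart_src es (Suc (2 * k)))"
    and "sem load_edge s ''h'' = (s ''h'')(2 * k := dart_dst es (2 * k), Suc (2 * k) := dart_dst es (Suc (2 * k)))"
    and "sem load_edge s ''c'' = (s ''c'')(2 * k := dart_cost es (2 * k), Suc (2 * k) := dart_cost es (Suc (2 * k)))"
  using assms
  by (simp_all add: load_edge_def frame_scale_cost scale_cost val_field
      dart_src_def dart_dst_def dart_cost_def int_cost_def mult_2 fun_upd_def)

lemma load_darts:
  assumes "s ''input'' = inp"
  shows "loaded (sem load_darts s)"
proof -
  let ?I = "\<lambda>k s'. s' ''input'' = inp \<and> s' ''i'' 0 = k \<and>
    (\<forall>d<2 * k. s' ''t'' d = dart_src es d \<and> s' ''h'' d = dart_dst es d \<and> s' ''c'' d = dart_cost es d)"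
  have "?I (expr_val count s) (sem load_darts s)"
    unfolding load_darts_def
  proof (rule sem_For_induct[where I = ?I], goal_cases)
    case 1
    show ?case using assms by (simp add: put_def)
  next
    case (2 k s')
    then have k: "k < m" using assms by simp
    have "sem load_edge s' ''input'' = s' ''input''"
      by (rule sem_frame) (simp add: load_edge_def scale_cost_def)
    then show ?case
      using 2(2) load_edge[of s' k] k by (auto simp: put_def less_Suc_eq)
  qed
  then show ?thesis using assms by (simp add: loaded_def)
qed

lemma frame_upd [simp]:
  "x \<notin> {''input'', ''t'', ''h'', ''c''} \<Longrightarrow> loaded (s(x := f)) = loaded s"
  "x \<notin> {''input'', ''t'', ''h'', ''c'', ''a'', ''b''} \<Longrightarrow> ranked (s(x := f)) = ranked s"
  "x \<notin> {''input'', ''t'', ''h'', ''c'', ''a'', ''b'', ''z''} \<Longrightarrow> based (s(x := f)) = based s"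
  "x \<noteq> ''output'' \<Longrightarrow> selected (s(x := f)) = selected s"
  "x \<noteq> ''K'' \<Longrightarrow> covered (s(x := f)) = covered s"
  by (auto simp: loaded_def ranked_def based_def selected_def covered_def)

lemma selected_upd [simp]: "selected (s(''output'' := (s ''output'')(i := Suc 0))) = insert i (selected s)"
  by (auto simp: selected_def)

lemma covered_upd [simp]: "covered (s(''K'' := (s ''K'')(v := Suc 0))) = insert v (covered s)"
  by (auto simp: covered_def)

lemma covered_iff: "s ''K'' v = 0 \<longleftrightarrow> v \<notin> covered s"
  by (simp add: covered_def)

lemma loadedD:
  assumes "loaded s"
  shows "s ''input'' = inp" "d < 2 * m \<Longrightarrow> s ''t'' d = dart_src es d"
    "d < 2 * m \<Longrightarrow> s ''h'' d = dart_dst es d" "d < 2 * m \<Longrightarrow> s ''c'' d = dart_cost es d"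
  using assms by (auto simp: loaded_def)

lemma rankedD:
  assumes "ranked s"
  shows "loaded s" "d < 2 * m \<Longrightarrow> s ''a'' d = rk (dart_src es d) d"
    "d < 2 * m \<Longrightarrow> s ''b'' d = rk (dart_dst es d) d"
  using assms by (auto simp: ranked_def)

lemma basedD:
  assumes "based s"
  shows "ranked s" "s ''z'' v = base v"
  using assms by (auto simp: based_def)

lemma loop_count:
  "loaded s \<Longrightarrow> expr_val darts_count s = 2 * m"
  by (simp add: loaded_def)

lemma count_cheaper:
  assumes "loaded s" "s ''d'' 0 = d" "d < 2 * m" "s ''k'' 0 = 0" "s ''l'' 0 = 0"
  shows "sem count_cheaper s ''k'' 0 = rk (dart_src es d) d"
    and "sem count_cheaper s ''l'' 0 = rk (dart_dst es d) d"
proof -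
  let ?I = "\<lambda>k s'. loaded s' \<and> s' ''d'' 0 = d \<and> s' ''f'' 0 = k \<and>
    s' ''k'' 0 = card {x \<in> {..<k}. dart_src es x = dart_src es d \<and> cheaper x d} \<and>
    s' ''l'' 0 = card {x \<in> {..<k}. dart_src es x = dart_dst es d \<and> cheaper x d}"
  have "?I (expr_val darts_count s) (sem count_cheaper s)"
    unfolding count_cheaper_def
  proof (rule sem_For_induct[where I = ?I], goal_cases)
    case 1
    show ?case using assms by (simp add: put_def)
  next
    case (2 k s')
    then have k: "k < 2 * m" using loop_count[OF assms(1)] by (simp only:)
    note val = loadedD(2-4)[of s' k] loadedD(2-4)[of s' d]
    show ?case unfolding card_filter_Suc
      using 2(2) k assms(3) val by (simp add: put_def Cheaper_def cheaper_def)
  qed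
  then show "sem count_cheaper s ''k'' 0 = rk (dart_src es d) d"
    "sem count_cheaper s ''l'' 0 = rk (dart_dst es d) d"
    using loop_count[OF assms(1)] by (simp_all add: rk_def)
qed

lemma frame_count_cheaper:
  "a \<notin> {''f'', ''k'', ''l''} \<Longrightarrow> sem count_cheaper s a = s a"
  by (rule sem_frame) (simp add: count_cheaper_def)

lemma loaded_cong:
  "s ''input'' = s' ''input'' \<Longrightarrow> s ''t'' = s' ''t'' \<Longrightarrow> s ''h'' = s' ''h'' \<Longrightarrow> s ''c'' = s' ''c'' \<Longrightarrow>
    loaded s = loaded s'"
  by (simp add: loaded_def)

lemma rank_darts:
  assumes "loaded s"
  shows "ranked (sem rank_darts s)"
proof -
  let ?I = "\<lambda>k s'. loaded s' \<and> s' ''d'' 0 = k \<and>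
    (\<forall>d<k. s' ''a'' d = rk (dart_src es d) d \<and> s' ''b'' d = rk (dart_dst es d) d)"
  have "?I (expr_val darts_count s) (sem rank_darts s)"
    unfolding rank_darts_def
  proof (rule sem_For_induct[where I = ?I], goal_cases)
    case 1
    show ?case using assms by (simp add: put_def)
  next
    case (2 k s')
    then have k: "k < 2 * m" using loop_count[OF assms] by (simp only:)
    have "loaded (sem count_cheaper s'') = loaded s''" for s''
      by (rule loaded_cong) (simp_all add: frame_count_cheaper)
    then show ?case
      using 2(2) k by (auto simp: put_def frame_count_cheaper count_cheaper less_Suc_eq)
  qed
  then show ?thesis using loop_count[OF assms] by (simp add: ranked_def)
qed

lemma val_bound_of:
  assumes "s ''input'' = inp" "expr_val e s < n"
  shows "expr_val (bound_of e) s = bound G (expr_val e s)"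
  using assms by (simp add: bound_of_def inp_bound)

lemma find_base:
  assumes "ranked s" "\<And>v. s ''z'' v = 0" "selected s = {}"
  shows "based (sem find_base s)" "selected (sem find_base s) = early_edges"
proof -
  let ?I = "\<lambda>k s'. ranked s' \<and> s' ''d'' 0 = k \<and>
    (\<forall>v. s' ''z'' v = (\<Sum>d | d < k \<and> (dart_src es d = v \<and> rk v d + 1 = bound G v). dart_cost es d)) \<and>
    selected s' = {d div 2 | d. d < k \<and> rk (dart_src es d) d + 1 < bound G (dart_src es d)}"
  have "?I (expr_val darts_count s) (sem find_base s)"
    unfolding find_base_def
  proof (rule sem_For_induct[where I = ?I], goal_cases)
    case 1
    show ?case using assms by (simp add: put_def)
  next
    case (2 k s')
    then have k: "k < 2 * m" using loop_count[OF rankedD(1)[OF assms(1)]] by simp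
    have val: "s' ''input'' = inp" "s' ''t'' k = dart_src es k" "s' ''c'' k = dart_cost es k"
      "s' ''a'' k = rk (dart_src es k) k"
      using 2(2) k by (auto simp: ranked_def loaded_def)
    have sel: "{d div 2 | d. d < Suc k \<and> rk (dart_src es d) d + 1 < bound G (dart_src es d)} =
      {d div 2 | d. d < k \<and> rk (dart_src es d) d + 1 < bound G (dart_src es d)} \<union>
      (if rk (dart_src es k) k + 1 < bound G (dart_src es k) then {k div 2} else {})"
      by (auto simp: less_Suc_eq)
    show ?case unfolding sum_filter_Suc sel
      using 2(2) src_less[OF k] val by (auto simp: put_def val_bound_of)
  qed
  then show "based (sem find_base s)" "selected (sem find_base s) = early_edges"
    using loop_count[OF rankedD(1)[OF assms(1)]]
    by (simp_all add: based_def base_def early_edges_def)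
qed

lemma val_Late:
  assumes "s ''input'' = inp" "expr_val e s < n" "expr_val f s = rk (expr_val e s) d"
  shows "expr_val (Late e f) s = 0 \<longleftrightarrow> \<not> late (expr_val e s) d"
  using assms by (auto simp: Late_def late_def val_bound_of)

lemma val_Loss: "expr_val (Loss e f) s = 2 * (s ''c'' (expr_val f s) - s ''z'' (expr_val e s))"
  by (simp add: Loss_def)

lemma basedD':
  assumes "based s" "d < 2 * m"
  shows "s ''input'' = inp" "s ''t'' d = dart_src es d" "s ''h'' d = dart_dst es d"
    "s ''c'' d = dart_cost es d" "s ''a'' d = rk (dart_src es d) d" "s ''b'' d = rk (dart_dst es d) d"
  using assms by (auto simp: based_def ranked_def loaded_def)

text \<open>The loop never writes the coverage array, so every dart is judged against the same
  \<open>K\<close>, as in \<open>star\<close>.\<close>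

lemma collect_star:
  assumes "based s" "s ''d'' 0 = d0" "d0 < 2 * m"
  defines "K \<equiv> covered s"
  shows "\<forall>d<2 * m. sem collect_star s ''s'' d \<noteq> 0 \<longleftrightarrow> d \<in> star K d0"
    and "sem collect_star s ''g'' 0 = s ''g'' 0 + (\<Sum>d\<in>star K d0. leaf_gain K d)"
    and "sem collect_star s ''l'' 0 = s ''l'' 0 + (\<Sum>d\<in>star K d0. 2 * excess (dart_dst es d) d)"
proof -
  let ?I = "\<lambda>k s'. based s' \<and> covered s' = K \<and> s' ''d'' 0 = d0 \<and> s' ''f'' 0 = k \<and>
    (\<forall>d<k. s' ''s'' d \<noteq> 0 \<longleftrightarrow> d \<in> star K d0) \<and>
    s' ''g'' 0 = s ''g'' 0 + (\<Sum>d | d < k \<and> d \<in> star K d0. leaf_gain K d) \<and>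
    s' ''l'' 0 = s ''l'' 0 + (\<Sum>d | d < k \<and> d \<in> star K d0. 2 * excess (dart_dst es d) d)"
  have "?I (expr_val darts_count s) (sem collect_star s)"
    unfolding collect_star_def
  proof (rule sem_For_induct[where I = ?I], goal_cases)
    case 1
    show ?case using assms by (simp add: put_def)
  next
    case (2 k s')
    then have k: "k < 2 * m" using loop_count[OF rankedD(1)[OF basedD(1)[OF assms(1)]]] by simp
    have b: "based s'" "s' ''d'' 0 = d0" "s' ''f'' 0 = k" "covered s' = K" using 2(2) by auto
    note val = basedD'[OF b(1) k] basedD'[OF b(1) assms(3)]
    define s1 where "s1 = sem (Branch (EAnd (ENot (Covered (Dst (Var ''f'')))) (Late (Dst (Var ''f'')) (dst_rank (Var ''f''))))
        (set_var ''u'' (Base (Dst (Var ''f'')))) (set_var ''u'' (Num 0))) s'"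
    have s1: "s1 ''u'' 0 = leaf_gain K k" "\<And>a. a \<noteq> ''u'' \<Longrightarrow> s1 a = s' a"
      using val b k dst_less[OF k] val_Late[of s' "Dst (Var ''f'')" "dst_rank (Var ''f'')" k]
      by (simp_all add: s1_def leaf_gain_def basedD(2) covered_iff)
    define s2 where "s2 = sem (set_var ''w'' (Loss (Dst (Var ''f'')) (Var ''f''))) s1"
    have s2: "s2 ''u'' 0 = leaf_gain K k" "s2 ''w'' 0 = 2 * excess (dart_dst es k) k"
      "\<And>a. a \<notin> {''u'', ''w''} \<Longrightarrow> s2 a = s' a"
      using val b s1 by (simp_all add: s2_def val_Loss excess_def basedD(2))
    have s2': "based s2" "covered s2 = K"
      using b(1,4) s2(3) by (simp_all add: based_def ranked_def loaded_def covered_def)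
    have star: "k \<in> star K d0 \<longleftrightarrow> k = d0 \<or> (dart_src es k = dart_src es d0 \<and>
        \<not> dart_cost es d0 < dart_cost es k \<and> 2 * excess (dart_dst es k) k < leaf_gain K k)"
      using k by (auto simp: star_def)
    show ?case unfolding sem.simps(3) s1_def[symmetric] s2_def[symmetric] sum_filter_Suc
      using 2(2) s2 s2' val by (auto simp: put_def star less_Suc_eq)
  qed
  moreover have "{d. d < 2 * m \<and> d \<in> star K d0} = star K d0" by (auto simp: star_def)
  ultimately show "\<forall>d<2 * m. sem collect_star s ''s'' d \<noteq> 0 \<longleftrightarrow> d \<in> star K d0"
    "sem collect_star s ''g'' 0 = s ''g'' 0 + (\<Sum>d\<in>star K d0. leaf_gain K d)"
    "sem collect_star s ''l'' 0 = s ''l'' 0 + (\<Sum>d\<in>star K d0. 2 * excess (dart_dst es d) d)"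
    using loop_count[OF rankedD(1)[OF basedD(1)[OF assms(1)]]] by simp_all
qed

lemma frame_collect_star:
  "a \<notin> {''f'', ''u'', ''w'', ''s'', ''g'', ''l''} \<Longrightarrow> sem collect_star s a = s a"
  by (rule sem_frame) (simp add: collect_star_def)

lemma frame_apply_star:
  "a \<notin> {''f'', ''output'', ''K''} \<Longrightarrow> sem apply_star s a = s a"
  by (rule sem_frame) (simp add: apply_star_def)

lemma apply_star:
  assumes "based s" and S: "\<forall>d<2 * m. s ''s'' d \<noteq> 0 \<longleftrightarrow> d \<in> S" "S \<subseteq> {..<2 * m}"
  shows "selected (sem apply_star s) = selected s \<union> (\<lambda>d. d div 2) ` S"
    and "covered (sem apply_star s) = covered s \<union> dart_dst es ` {d \<in> S. late (dart_dst es d) d}"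
proof -
  let ?I = "\<lambda>k s'. based s' \<and> s' ''s'' = s ''s'' \<and> s' ''f'' 0 = k \<and>
    selected s' = selected s \<union> (\<lambda>d. d div 2) ` {d \<in> S. d < k} \<and>
    covered s' = covered s \<union> dart_dst es ` {d \<in> S. d < k \<and> late (dart_dst es d) d}"
  have "?I (expr_val darts_count s) (sem apply_star s)"
    unfolding apply_star_def
  proof (rule sem_For_induct[where I = ?I], goal_cases)
    case 1
    show ?case using assms by (simp add: put_def)
  next
    case (2 k s')
    then have k: "k < 2 * m" using loop_count[OF rankedD(1)[OF basedD(1)[OF assms(1)]]] by simp
    have b: "based s'" "s' ''f'' 0 = k" using 2(2) by auto
    note val = basedD'[OF b(1) k]
    define s1 where "s1 = s'(''output'' := (s' ''output'')(k div 2 := Suc 0))"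
    have late: "expr_val (Late (Dst (Var ''f'')) (dst_rank (Var ''f''))) s1 = 0 \<longleftrightarrow> \<not> late (dart_dst es k) k"
      using val b dst_less[OF k] val_Late[of s1 "Dst (Var ''f'')" "dst_rank (Var ''f'')" k]
      by (simp add: s1_def)
    have sel: "(\<lambda>d. d div 2) ` {d \<in> S. d < Suc k} =
      (\<lambda>d. d div 2) ` {d \<in> S. d < k} \<union> (if k \<in> S then {k div 2} else {})"
      by (auto simp: less_Suc_eq)
    have cov: "dart_dst es ` {d \<in> S. d < Suc k \<and> late (dart_dst es d) d} =
      dart_dst es ` {d \<in> S. d < k \<and> late (dart_dst es d) d} \<union>
      (if k \<in> S \<and> late (dart_dst es k) k then {dart_dst es k} else {})"
      by (auto simp: less_Suc_eq)
    have ks: "s' ''s'' k \<noteq> 0 \<longleftrightarrow> k \<in> S" using S(1) k 2(2) by simp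
    show ?case
    proof (cases "k \<in> S")
      case True
      have "sem (Assign ''output'' (Half (Var ''f'')) (Num 1)) s' = s1"
        using b by (simp add: s1_def)
      then show ?thesis unfolding sel cov using 2(2) ks True val
        by (simp add: late put_def) (simp add: s1_def)
    next
      case False
      then show ?thesis unfolding sel cov using 2(2) ks by (simp add: put_def)
    qed
  qed
  moreover have "{d \<in> S. d < 2 * m} = S" "{d \<in> S. d < 2 * m \<and> late (dart_dst es d) d} = {d \<in> S. late (dart_dst es d) d}"
    using S(2) by auto
  ultimately show "selected (sem apply_star s) = selected s \<union> (\<lambda>d. d div 2) ` S"
    "covered (sem apply_star s) = covered s \<union> dart_dst es ` {d \<in> S. late (dart_dst es d) d}"
    using loop_count[OF rankedD(1)[OF basedD(1)[OF assms(1)]]] by simp_all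
qed

text \<open>One round realises one abstract \<open>step\<close>. The body is written out literally
  to match what the loop rule leaves for \<open>greedy_pass\<close>.\<close>

lemma greedy_body:
  assumes "based s" "s ''d'' 0 = d" "d < 2 * m"
  defines "s' \<equiv> sem
    (Branch (EAnd (ENot (Covered (Src (Var ''d'')))) (Late (Src (Var ''d'')) (src_rank (Var ''d''))))
        (set_var ''g'' (Base (Src (Var ''d'')))) (set_var ''g'' (Num 0)) ;;
      set_var ''l'' (Loss (Src (Var ''d'')) (Var ''d'')) ;;
      collect_star ;;
      Branch (ELess (Var ''l'') (Var ''g''))
        (apply_star ;;
         Branch (Late (Src (Var ''d'')) (src_rank (Var ''d''))) (Assign ''K'' (Src (Var ''d'')) (Num 1)) Nop)
        Nop) s"
  shows "based s'" "(covered s', selected s') = step d (covered s, selected s)"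
proof -
  note val = basedD'[OF assms(1,3)]
  define K where "K = covered s"
  define s1 where "s1 = sem (Branch (EAnd (ENot (Covered (Src (Var ''d'')))) (Late (Src (Var ''d'')) (src_rank (Var ''d''))))
        (set_var ''g'' (Base (Src (Var ''d'')))) (set_var ''g'' (Num 0))) s"
  have s1: "s1 ''g'' 0 = centre_gain K d" "\<And>a. a \<noteq> ''g'' \<Longrightarrow> s1 a = s a"
    using val assms(2) src_less[OF assms(3)] val_Late[of s "Src (Var ''d'')" "src_rank (Var ''d'')" d]
    by (simp_all add: s1_def centre_gain_def basedD(2)[OF assms(1)] covered_iff K_def)
  define s2 where "s2 = sem (set_var ''l'' (Loss (Src (Var ''d'')) (Var ''d''))) s1"
  have s2: "s2 ''g'' 0 = centre_gain K d" "s2 ''l'' 0 = 2 * excess (dart_src es d) d"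
    "\<And>a. a \<notin> {''g'', ''l''} \<Longrightarrow> s2 a = s a"
    using val assms(2) s1 by (simp_all add: s2_def val_Loss excess_def basedD(2)[OF assms(1)])
  have s2': "based s2" "covered s2 = K" "s2 ''d'' 0 = d"
    using assms(1,2) s2(3) by (simp_all add: based_def ranked_def loaded_def covered_def K_def)
  define s3 where "s3 = sem collect_star s2"
  have s3: "\<forall>x<2 * m. s3 ''s'' x \<noteq> 0 \<longleftrightarrow> x \<in> star K d"
    "s3 ''g'' 0 = gain K d" "s3 ''l'' 0 = loss K d"
    using collect_star[OF s2'(1,3) assms(3)] s2 s2' by (auto simp: s3_def gain_def loss_def)
  have s3_frame: "\<And>a. a \<notin> {''f'', ''u'', ''w'', ''s'', ''g'', ''l''} \<Longrightarrow> s3 a = s a"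
    using s2(3) by (simp add: s3_def frame_collect_star)
  have s3': "based s3" "covered s3 = K" "selected s3 = selected s"
    using assms(1) s3_frame by (simp_all add: based_def ranked_def loaded_def covered_def selected_def K_def)
  define s4 where "s4 = sem apply_star s3"
  have s4: "selected s4 = selected s \<union> (\<lambda>d. d div 2) ` star K d"
    "covered s4 = K \<union> dart_dst es ` {x \<in> star K d. late (dart_dst es x) x}"
    using apply_star[OF s3'(1) s3(1)] s3' by (auto simp: s4_def star_def)
  have s4_frame: "\<And>a. a \<notin> {''f'', ''u'', ''w'', ''s'', ''g'', ''l'', ''output'', ''K''} \<Longrightarrow> s4 a = s a"
    using s3_frame by (simp add: s4_def frame_apply_star)
  have s4': "based s4" using assms(1) s4_frame by (simp add: based_def ranked_def loaded_def)
  define s5 where "s5 = (if late (dart_src es d) d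
    then s4(''K'' := (s4 ''K'')(dart_src es d := Suc 0)) else s4)"
  have "expr_val (Late (Src (Var ''d'')) (src_rank (Var ''d''))) s4 = 0 \<longleftrightarrow> \<not> late (dart_src es d) d"
    using val assms(2) src_less[OF assms(3)] s4_frame val_Late[of s4 "Src (Var ''d'')" "src_rank (Var ''d'')" d]
    by simp
  then have s5: "sem (Branch (Late (Src (Var ''d'')) (src_rank (Var ''d''))) (Assign ''K'' (Src (Var ''d'')) (Num 1)) Nop) s4 = s5"
    using val assms(2) s4_frame by (simp add: s5_def)
  have "sem (apply_star ;;
      Branch (Late (Src (Var ''d'')) (src_rank (Var ''d''))) (Assign ''K'' (Src (Var ''d'')) (Num 1)) Nop) s3 = s5"
    by (simp only: sem.simps(3) s4_def[symmetric] s5)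
  moreover have "expr_val (ELess (Var ''l'') (Var ''g'')) s3 = 0 \<longleftrightarrow> \<not> loss K d < gain K d"
    using s3(2,3) by simp
  ultimately have s': "s' = (if loss K d < gain K d then s5 else s3)"
    unfolding s'_def sem.simps(3)[of _ "_ ;; _"] sem.simps(3)[of "Assign _ _ _"]
      sem.simps(3)[of collect_star] s1_def[symmetric] s2_def[symmetric] s3_def[symmetric]
    by (simp only: sem.simps(1,4) if_not_P simp_thms split: if_split)
  show "based s'" using s3' s4' by (simp add: s' s5_def)
  show "(covered s', selected s') = step d (covered s, selected s)"
    unfolding K_def[symmetric] step_def using s4 s3' by (auto simp: s' s5_def)
qed

lemma greedy_pass:
  assumes "based s" "selected s = early_edges" "covered s = {}"
  shows "based (sem greedy_pass s)"
    "(covered (sem greedy_pass s), selected (sem greedy_pass s)) = greedy [0..<2 * m]"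
proof -
  let ?I = "\<lambda>k s'. based s' \<and> s' ''d'' 0 = k \<and> (covered s', selected s') = greedy [0..<k]"
  have "?I (expr_val darts_count s) (sem greedy_pass s)"
    unfolding greedy_pass_def
  proof (rule sem_For_induct[where I = ?I], goal_cases)
    case 1
    show ?case using assms by (simp add: put_def greedy_def)
  next
    case (2 k s')
    then have k: "k < 2 * m" using loop_count[OF rankedD(1)[OF basedD(1)[OF assms(1)]]] by simp
    then show ?case using greedy_body[of s' k] 2(2) by (simp add: put_def greedy_def)
  qed
  then show "based (sem greedy_pass s)"
    "(covered (sem greedy_pass s), selected (sem greedy_pass s)) = greedy [0..<2 * m]"
    using loop_count[OF rankedD(1)[OF basedD(1)[OF assms(1)]]] by simp_all
qed

lemma add_fallback:
  assumes "based s"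
  shows "selected (sem add_fallback s) = selected s \<union> fallback (covered s)"
proof -
  let ?Q = "\<lambda>d. rk (dart_src es d) d + 1 = bound G (dart_src es d) \<and> dart_src es d \<notin> covered s"
  let ?I = "\<lambda>k s'. based s' \<and> s' ''K'' = s ''K'' \<and> s' ''d'' 0 = k \<and>
    selected s' = selected s \<union> (\<lambda>d. d div 2) ` {d. d < k \<and> ?Q d}"
  have "?I (expr_val darts_count s) (sem add_fallback s)"
    unfolding add_fallback_def
  proof (rule sem_For_induct[where I = ?I], goal_cases)
    case 1
    show ?case using assms by (simp add: put_def)
  next
    case (2 k s')
    then have k: "k < 2 * m" using loop_count[OF rankedD(1)[OF basedD(1)[OF assms(1)]]] by simp
    have b: "based s'" "s' ''d'' 0 = k" "s' ''K'' = s ''K''" using 2(2) by auto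
    note val = basedD'[OF b(1) k]
    have sel: "(\<lambda>d. d div 2) ` {d. d < Suc k \<and> ?Q d} =
      (\<lambda>d. d div 2) ` {d. d < k \<and> ?Q d} \<union> (if ?Q k then {k div 2} else {})"
      by (auto simp: less_Suc_eq)
    show ?case unfolding sel using 2(2) val b src_less[OF k] covered_iff[of s]
      by (simp add: put_def val_bound_of)
  qed
  then show ?thesis
    using loop_count[OF rankedD(1)[OF basedD(1)[OF assms(1)]]] by (auto simp: fallback_def)
qed

text \<open>The program processes the darts in numerical order; the guarantee for
  \<open>chosen\<close> holds for any list of all darts.\<close>

lemma selected_mpemc_com:
  "selected (sem mpemc_com (input_memory (encode G es))) = chosen [0..<2 * m]"
proof -
  define s0 where "s0 = input_memory (encode G es)"
  define s1 where "s1 = sem rank_darts (sem load_darts s0)"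
  have "s0 ''input'' = inp" by (simp add: s0_def inp_def)
  then have 1: "ranked s1" unfolding s1_def by (intro rank_darts load_darts)
  \<comment> \<open>Loading and ranking leave these arrays alone, so their initial zeros still say
    that no base value, selection or coverage is recorded.\<close>
  have "s1 a = s0 a" if "a \<in> {''z'', ''output'', ''K''}" for a
    using that sem_frame[of a rank_darts] sem_frame[of a load_darts]
    by (auto simp: s1_def rank_darts_def count_cheaper_def load_darts_def load_edge_def scale_cost_def)
  then have 0: "s1 a v = 0" if "a \<in> {''z'', ''output'', ''K''}" for a v
    using that by (auto simp: s0_def input_memory_def)
  have sel: "selected s1 = {}" and cov: "covered s1 = {}"
    using 0 by (auto simp: selected_def covered_def)
  define s2 where "s2 = sem find_base s1"
  have 2: "based s2" "selected s2 = early_edges"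
    using find_base[OF 1 _ sel] 0 by (auto simp: s2_def)
  have "s2 ''K'' = s1 ''K''" unfolding s2_def by (rule sem_frame) (simp add: find_base_def)
  then have "covered s2 = {}" using cov by (simp add: covered_def)
  note 3 = greedy_pass[OF 2 this]
  show ?thesis
    using add_fallback[OF 3(1)] 3(2)
    by (simp add: mpemc_com_def s0_def[symmetric] s1_def[symmetric] s2_def[symmetric] chosen_def flip: 3(2))
qed

section \<open>Power of the computed edge set\<close>

definition edge_set :: "nat set \<Rightarrow> nat set set" where
  "edge_set J = {edge_of (es ! i) | i. i < m \<and> i \<in> J}"

definition scale :: nat where
  "scale = (\<Prod>j<m. denom es j)"

lemma scale_pos: "0 < scale"
proof -
  have "0 < denom es j" if "j < m" for j
    using listing nth_mem[OF that] by (force simp: edge_listing_def denom_def)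
  then show ?thesis unfolding scale_def by (simp add: prod_pos)
qed

lemma scale_cost_eq:
  assumes "i < m"
  shows "of_nat scale * cost G (edge_of (es ! i)) = of_nat (int_cost es i)"
proof -
  obtain u v a b where e: "es ! i = (u, v, a, b)" by (cases "es ! i")
  then have "(u, v, a, b) \<in> set es" using assms nth_mem by metis
  then have b: "b > 0" and c: "cost G {u, v} = of_nat a / of_nat b"
    using listing by (auto simp: edge_listing_def)
  have "scale = denom es i * (\<Prod>j\<in>{..<m} - {i}. denom es j)"
    unfolding scale_def using assms by (intro prod.remove) auto
  then show ?thesis using b c by (simp add: e edge_of_def int_cost_def denom_def)
qed

text \<open>The bridge from edges as vertex pairs to darts: degree and power at \<open>v\<close>
  become statements about \<open>darts_at v\<close>.\<close>

lemma incident_edge_set: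
  "incident (edge_set J) v = (\<lambda>d. edge_of (es ! (d div 2))) ` {d \<in> darts_at v. d div 2 \<in> J}"
proof (intro equalityI subsetI)
  fix e assume "e \<in> incident (edge_set J) v"
  then obtain i where i: "e = edge_of (es ! i)" "i < m" "i \<in> J" "v \<in> e"
    by (auto simp: incident_def edge_set_def)
  then have "v = dart_src es (2 * i) \<or> v = dart_src es (Suc (2 * i))"
    using edge_of_dart[of "2 * i"] by (auto simp: dart_src_def dart_dst_def)
  then obtain d where "d div 2 = i" "v = dart_src es d" "d < 2 * m"
    using i(2) that by (elim disjE) (auto intro: that[of "2 * i"] that[of "Suc (2 * i)"])
  then show "e \<in> (\<lambda>d. edge_of (es ! (d div 2))) ` {d \<in> darts_at v. d div 2 \<in> J}"
    using i by (intro image_eqI[of _ _ d]) (auto simp: darts_at_def)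
next
  fix e assume "e \<in> (\<lambda>d. edge_of (es ! (d div 2))) ` {d \<in> darts_at v. d div 2 \<in> J}"
  then obtain d where d: "d \<in> darts_at v" "d div 2 \<in> J" "e = edge_of (es ! (d div 2))" by auto
  then have "d div 2 < m" by (auto simp: darts_at_def)
  then have "e \<in> edge_set J" using d by (auto simp: edge_set_def)
  moreover have "v \<in> e" using d edge_of_dart[of d] by (simp add: darts_at_def)
  ultimately show "e \<in> incident (edge_set J) v" by (simp add: incident_def)
qed

lemma degree_edge_set: "degree_in (edge_set J) v = card {d \<in> darts_at v. d div 2 \<in> J}"
  unfolding degree_in_def incident_edge_set
proof (rule card_image, rule inj_onI)
  fix d d' assume "d \<in> {d \<in> darts_at v. d div 2 \<in> J}" "d' \<in> {d \<in> darts_at v. d div 2 \<in> J}"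
    and eq: "edge_of (es ! (d div 2)) = edge_of (es ! (d' div 2))"
  then have d: "d \<in> darts_at v" "d' \<in> darts_at v" by auto
  then have "d div 2 < m" "d' div 2 < m" by (auto simp: darts_at_def)
  then have "d div 2 = d' div 2" using eq by (rule edge_of_inj)
  then show "d = d'" using d by (rule inj_onD[OF inj_on_ed_darts_at])
qed

lemma edge_set_solution: "edge_set J \<in> solutions G \<longleftrightarrow> feasible J"
proof -
  have "edge_set J \<subseteq> edges G" using edge_of_edges by (auto simp: edge_set_def)
  then show ?thesis by (simp add: solutions_def edge_cover_def feasible_def degree_edge_set)
qed

lemma solution_edge_set:
  assumes "S \<in> solutions G"
  shows "S = edge_set {i. i < m \<and> edge_of (es ! i) \<in> S}"
proof -
  have "S \<subseteq> edge_of ` set es" using assms listing by (auto simp: solutions_def edge_listing_def)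
  then have "\<exists>i<m. e = edge_of (es ! i)" if "e \<in> S" for e
    using that by (auto simp: in_set_conv_nth image_iff) (metis subsetD imageE in_set_conv_nth)
  then show ?thesis by (auto simp: edge_set_def)
qed

text \<open>Together with \<open>node_power_ge\<close> this identifies the scaled power with the
  least level. This direction serves the computed set, the other one the optimal set.\<close>

lemma node_power_le:
  assumes "\<And>d. d \<in> darts_at v \<Longrightarrow> d div 2 \<in> J \<Longrightarrow> dart_cost es d \<le> M"
  shows "of_nat scale * node_power (cost G) (edge_set J) v \<le> of_nat M"
proof (cases "incident (edge_set J) v = {}")
  case False
  have "finite (incident (edge_set J) v)" unfolding incident_edge_set by simp
  with False have "node_power (cost G) (edge_set J) v \<in> cost G ` incident (edge_set J) v"
    unfolding node_power_def using Max_in[of "cost G ` incident (edge_set J) v"] by simp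
  then obtain d where d: "d \<in> darts_at v" "d div 2 \<in> J"
    "node_power (cost G) (edge_set J) v = cost G (edge_of (es ! (d div 2)))"
    unfolding incident_edge_set by auto
  then have "of_nat scale * node_power (cost G) (edge_set J) v = of_nat (dart_cost es d)"
    using scale_cost_eq[of "d div 2"] by (auto simp: darts_at_def dart_cost_def)
  then show ?thesis using assms d by simp
qed (simp add: node_power_def)

lemma node_power_ge:
  assumes "d \<in> darts_at v" "d div 2 \<in> J"
  shows "of_nat (dart_cost es d) \<le> of_nat scale * node_power (cost G) (edge_set J) v"
proof -
  have fin: "finite (incident (edge_set J) v)" unfolding incident_edge_set by simp
  have mem: "edge_of (es ! (d div 2)) \<in> incident (edge_set J) v"
    unfolding incident_edge_set using assms by auto
  then have "cost G (edge_of (es ! (d div 2))) \<le> node_power (cost G) (edge_set J) v"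
    unfolding node_power_def using fin by (auto intro: Max_ge)
  then have "of_nat scale * cost G (edge_of (es ! (d div 2)))
      \<le> of_nat scale * node_power (cost G) (edge_set J) v"
    by (rule mult_left_mono) simp
  then show ?thesis
    using assms scale_cost_eq[of "d div 2"] by (auto simp: darts_at_def dart_cost_def)
qed

lemma node_power_nonneg: "0 \<le> node_power (cost G) (edge_set J) v"
proof (cases "incident (edge_set J) v = {}")
  case False
  then obtain d where "d \<in> darts_at v" "d div 2 \<in> J" unfolding incident_edge_set by auto
  then have "0 \<le> of_nat scale * node_power (cost G) (edge_set J) v"
    using node_power_ge order_trans of_nat_0_le_iff by blast
  then show ?thesis using scale_pos by (simp add: zero_le_mult_iff)
qed (simp add: node_power_def)

section \<open>Transfer of the guarantee to rational costs\<close>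

lemma optimal_solution:
  assumes "solutions G \<noteq> {}"
  obtains J where "J \<subseteq> {..<m}" "feasible J" "power_of G (edge_set J) = opt_power G"
proof -
  have "edges G = edge_of ` set es" using listing by (simp add: edge_listing_def)
  then have "finite (solutions G)" unfolding solutions_def by simp
  then have "opt_power G \<in> power_of G ` solutions G"
    unfolding opt_power_def using assms by (intro Min_in) auto
  then obtain S where S: "S \<in> solutions G" "power_of G S = opt_power G" by auto
  let ?J = "{i. i < m \<and> edge_of (es ! i) \<in> S}"
  show thesis
    by (rule that[of ?J]) (use S solution_edge_set[OF S(1)] edge_set_solution[of ?J] in auto)
qed

lemma approximation:
  assumes "solutions G \<noteq> {}"
  defines "R \<equiv> edge_set (chosen [0..<2 * m])"
  shows "R \<in> solutions G" "power_of G R \<le> (of_nat (max_bound G) + 1 / 2) * opt_power G"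
proof -
  obtain J where J: "J \<subseteq> {..<m}" "feasible J" "power_of G (edge_set J) = opt_power G"
    using optimal_solution[OF assms(1)] by blast
  \<comment> \<open>The optimal solution itself witnesses that all degrees suffice.\<close>
  interpret solvable_dart_graph "verts G" "{..<2 * m}" "dart_src es" "dart_dst es" dart_mate
    "\<lambda>d. d div 2" "dart_cost es" "bound G"
  proof
    fix v assume "v \<in> verts G"
    then have "bound G v \<le> card {d \<in> darts_at v. d div 2 \<in> J}" using J(2) by (simp add: feasible_def)
    also have "\<dots> \<le> card (darts_at v)" by (rule card_mono) auto
    finally show "bound G v \<le> card (darts_at v)" .
  qed
  have ds: "set [0..<2 * m] = {..<2 * m}" by auto
  show "R \<in> solutions G"
    unfolding R_def edge_set_solution by (rule chosen_feasible[OF ds])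
  \<comment> \<open>The scaled power of the optimum as a natural number; the inserted 0 serves
    vertices without an edge of \<open>J\<close>.\<close>
  define L where "L v = Max (insert 0 (dart_cost es ` {d \<in> darts_at v. d div 2 \<in> J}))" for v
  have L1: "dart_cost es d \<le> L (dart_src es d)" if "d \<in> {..<2 * m}" "d div 2 \<in> J" for d
    unfolding L_def by (rule Max_ge) (use that in \<open>auto simp: darts_at_def\<close>)
  have L2: "of_nat (L v) \<le> of_nat scale * node_power (cost G) (edge_set J) v" for v
  proof -
    have "L v \<in> insert 0 (dart_cost es ` {d \<in> darts_at v. d div 2 \<in> J})"
      unfolding L_def by (rule Max_in) auto
    then consider "L v = 0" | d where "d \<in> darts_at v" "d div 2 \<in> J" "L v = dart_cost es d" by auto
    then show ?thesis using node_power_nonneg node_power_ge by cases auto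
  qed
  have k: "bound G v \<le> max_bound G" if "v \<in> verts G" for v
    unfolding max_bound_def using that finite_V by (intro Max_ge) auto
  have "i \<in> (\<lambda>d. d div 2) ` {..<2 * m}" if "i < m" for i
    using that by (intro image_eqI[of _ _ "2 * i"]) auto
  then have "J \<subseteq> (\<lambda>d. d div 2) ` {..<2 * m}" using J(1) by auto
  then obtain M where M: "\<And>d. d \<in> {..<2 * m} \<Longrightarrow> d div 2 \<in> chosen [0..<2 * m] \<Longrightarrow> dart_cost es d \<le> M (dart_src es d)"
    "2 * sum M (verts G) \<le> (2 * max_bound G + 1) * sum L (verts G)"
    using chosen_level[OF ds J(2) _ L1 k] by blast
  have "of_nat scale * power_of G R = (\<Sum>v\<in>verts G. of_nat scale * node_power (cost G) R v)"
    by (simp add: power_of_def power_on_def sum_distrib_left)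
  also have "\<dots> \<le> (\<Sum>v\<in>verts G. of_nat (M v))"
    unfolding R_def by (intro sum_mono node_power_le) (use M(1) in \<open>auto simp: darts_at_def\<close>)
  also have "\<dots> = of_nat (2 * sum M (verts G)) / 2" by simp
  also have "\<dots> \<le> of_nat ((2 * max_bound G + 1) * sum L (verts G)) / 2"
    by (intro divide_right_mono of_nat_mono M(2)) simp
  also have "\<dots> = (of_nat (max_bound G) + 1 / 2) * (\<Sum>v\<in>verts G. of_nat (L v))"
    by (simp add: field_simps)
  also have "\<dots> \<le> (of_nat (max_bound G) + 1 / 2) *
      (\<Sum>v\<in>verts G. of_nat scale * node_power (cost G) (edge_set J) v)"
    by (intro mult_left_mono sum_mono L2) simp
  also have "\<dots> = of_nat scale * ((of_nat (max_bound G) + 1 / 2) * opt_power G)"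
    by (simp add: J(3)[symmetric] power_of_def power_on_def sum_distrib_left mult.left_commute)
  finally show "power_of G R \<le> (of_nat (max_bound G) + 1 / 2) * opt_power G"
    using scale_pos by (simp add: mult_le_cancel_left)
qed

text \<open>Each input number contributes its binary length plus one to \<open>input_size\<close>.
  So this size bounds the binary lengths and, through the length of the list, also the number of
  edges, as \<open>exec_compile\<close> requires.\<close>

lemma exec_mpemc_com:
  "\<exists>t. exec (compile mpemc_com) (input_memory (encode G es)) t (sem mpemc_com (input_memory (encode G es))) \<and>
     t \<le> poly (time_poly mpemc_com) (input_size (encode G es))"
proof -
  let ?xs = "encode G es"
  have member: "Suc (floorlog 2 x) \<le> input_size ?xs" if "x \<in> set ?xs" for x
    unfolding input_size_def using that by (intro member_le_sum_list) auto
  have "length xs \<le> input_size xs" for xs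
    unfolding input_size_def by (induction xs) auto
  from this[of ?xs] have "m \<le> input_size ?xs" by (simp add: length_encode)
  then have "input_memory ?xs ''input'' 1 \<le> input_size ?xs"
    unfolding inp_def[symmetric] by simp
  moreover have "floorlog 2 (input_memory ?xs ''input'' i) \<le> input_size ?xs" for i
    using member[of "?xs ! i"] by (auto simp: input_memory_def floorlog_def)
  ultimately show ?thesis
    using exec_compile[OF wf_mpemc_com, of "input_memory ?xs" "input_size ?xs"] by blast
qed

lemma output_mpemc_com:
  "output_edges es (sem mpemc_com (input_memory (encode G es))) = edge_set (chosen [0..<2 * m])"
  unfolding selected_mpemc_com[symmetric] by (auto simp: output_edges_def edge_set_def selected_def)

end

theorem theorem2:
  "\<exists>P. mpemc_approximation P (\<lambda>G. of_nat (max_bound G) + 1 / 2)"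
proof (intro exI)
  show "mpemc_approximation (compile mpemc_com) (\<lambda>G. of_nat (max_bound G) + 1 / 2)"
    unfolding mpemc_approximation_def
  proof (intro exI[of _ "time_poly mpemc_com"] allI impI)
    fix G es
    assume G: "mpemc_instance G \<and> verts G = {..<card (verts G)} \<and> edge_listing G es"
    interpret encoded_instance G es using G by unfold_locales blast+
    let ?s = "sem mpemc_com (input_memory (encode G es))"
    obtain t where "exec (compile mpemc_com) (input_memory (encode G es)) t ?s"
      "t \<le> poly (time_poly mpemc_com) (input_size (encode G es))" using exec_mpemc_com by blast
    then show "\<exists>t s. exec (compile mpemc_com) (input_memory (encode G es)) t s \<and>
        t \<le> poly (time_poly mpemc_com) (input_size (encode G es)) \<and>
        (solutions G \<noteq> {} \<longrightarrow> output_edges es s \<in> solutions G \<and>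
          power_of G (output_edges es s) \<le> (of_nat (max_bound G) + 1 / 2) * opt_power G)"
      using approximation output_mpemc_com by (intro exI[of _ t] exI[of _ ?s]) simp
  qed
qed

end
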